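(* Let $K_t\in\mathcal{K}_0$ and $$\rho>\max\left\{\frac{\ell}{\underline d}+m,\ \frac{\ell_{\mathcal M}}{\underline d}\right\}.$$ For the lower approximations $J_k$ constructed as described in the context (full-memory, two-cut, or general model), the minimizer $$L_{k+1}=\operatorname*{argmin}_{L\in\mathbb{R}^{n_u\times n_y}}J_k(L)+\frac\rho2\|L-K_t\|_F^2$$ satisfies $\|L_{k+1}-K_t\|_F<\underline d$, and thus $L_{k+1}\in\operatorname{int}(\widetilde{\mathcal K}_0)$, for all $k\ge0$.
   Context: **Problem.** Fix $A\in\mathbb{R}^{n_x\times n_x}$, $B\in\mathbb{R}^{n_x\times n_u}$, $B_w\in\mathbb{R}^{n_x\times n_w}$, $C\in\mathbb{R}^{n_y\times n_x}$ and symmetric $Q\in\mathbb{R}^{n_x\times n_x}$, $R\in\mathbb{R}^{n_u\times n_u}$. Standing assumptions: $(A,B)$ is stabilizable; $B_w$ and $C$ have full row rank; $Q,R$ are positive definite; and $\mathcal{K}:=\{K\in\mathbb{R}^{n_u\times n_y}\mid \text{all eigenvalues of }A+BKC\text{ have modulus}<1\}$ is nonempty. For $K\in\mathcal{K}$, $\omega\in[0,2\pi]$, let $\mathbf{T}_{zw}(K,\omega)=\begin{bmatrix}Q^{1/2}\\ R^{1/2}KC\end{bmatrix}(e^{j\omega}I-(A+BKC))^{-1}B_w$ and $J(K):=\max_{\omega\in[0,2\pi]}\sigma_{\max}(\mathbf{T}_{zw}(K,\omega))$. Let $J^\star=\min_{K\in\mathcal K}J(K)$. Inner products and norms on matrices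 are the trace inner product and Frobenius norm $\|\cdot\|_F$; $\operatorname{dist}$ is the induced distance. $\partial f(\bar x)=\{v\mid \liminf_{y\to\bar x,y\neq\bar x}(f(y)-f(\bar x)-\langle v,y-\bar x\rangle)/\|y-\bar x\|\ge0\}$ is the Fréchet subdifferential (the usual convex subdifferential for convex $f$). A function $f$ is $m$-weakly convex on a convex set $U$ if $f+\frac m2\|\cdot\|^2$ is convex on $U$. **Constants.** $K_0\in\mathcal{K}$ is a given gain with $J(K_0)>J^\star$; $\mathcal{K}_0:=\{K\in\mathcal{K}\mid J(K)\le J(K_0)\}$; $\widetilde{\mathcal{K}}_0:=\{K\in\mathcal{K}\mid J(K)\le 2J(K_0)\}$. $m>0$ is such that $J$ is $m$-weakly convex on any convex subset of $\widetilde{\mathcal K}_0$, and $\ell>0$ is such that $J$ is $\ell$-Lipschitz on $\widetilde{\mathcal K}_0$. $\underline d:=\min_{K\in\mathcal{K}_0}\operatorname{dist}(K,\partial\widetilde{\mathcal K}_0)$, where $\partial\widetilde{\mathcal K}_0$ is the topological boundary (one has $\underline d>0$). $\mathcal{U}_{K_t}$ denotes the largest open ball centered at $K_t$ contained in $\operatorname{int}(\widetilde{\mathcal K}_0)$. **Models.** $L_0=K_t$, $J_0(L)=J(L_0)+\langle G_0,L-L_0\rangle$ with $G_0\in\partial J(L_0)$. Given $L_k$, for $k\ge1$, $J_k$ is given by one of: (1) full-memory: $J_k(L)=\max_{i=0,\dots,k}\left\{J(L_i)+\frac m2\|L_i-K_t\|_F^2+\langle G_i,L-L_i\rangle\right\}$;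 (2) two-cut: $J_k(L)=\max\left\{J(L_k)+\frac m2\|L_k-K_t\|_F^2+\langle G_k,L-L_k\rangle,\ J_{k-1}(L_k)+\langle S_k,L-L_k\rangle\right\}$; (3) general: $J_k(L)=\max\left\{\mathcal M_k(L),\ J(L_k)+\frac m2\|L_k-K_t\|_F^2+\langle G_k,L-L_k\rangle,\ J_{k-1}(L_k)+\langle S_k,L-L_k\rangle\right\}$. Here $G_i-m(L_i-K_t)\in\partial J(L_i)$, $S_k=\rho(K_t-L_k)\in\partial J_{k-1}(L_k)$, and $\mathcal M_k$ is a possibly nonsmooth function that is $\ell_{\mathcal M}$-Lipschitz on $\widetilde{\mathcal K}_0$ ($\ell_{\mathcal M}\ge0$ independent of $k$), convex on $\mathbb{R}^{n_u\times n_y}$, and satisfies $\mathcal M_k(L)\le J(L)+\frac m2\|L-K_t\|_F^2$ for all $L\in\mathcal U_{K_t}$. For models (1), (2) take $\ell_{\mathcal M}=0$. (The model $J_k$ at step $k$ uses $J$ and $\partial J$ at the points $L_0,\dots,L_k$.) *)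

theory Defs
  imports "HOL-Analysis.Analysis"
begin

(* Matrices with m rows and n columns have type "real ^ 'n ^ 'm".  The library inner product,
   norm and distance on this type are the trace inner product, the Frobenius norm and the
   distance it induces. *)

definition pos_def :: "real ^ 'n ^ 'n \<Rightarrow> bool" where
  "pos_def M \<longleftrightarrow> transpose M = M \<and> (\<forall>v. v \<noteq> 0 \<longrightarrow> v \<bullet> (M *v v) > 0)"

definition pos_semidef :: "real ^ 'n ^ 'n \<Rightarrow> bool" where
  "pos_semidef M \<longleftrightarrow> transpose M = M \<and> (\<forall>v. v \<bullet> (M *v v) \<ge> 0)"

definition psd_sqrt :: "real ^ 'n ^ 'n \<Rightarrow> real ^ 'n ^ 'n" where
  "psd_sqrt M = (THE S. pos_semidef S \<and> S ** S = M)"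

definition full_row_rank :: "real ^ 'n ^ 'm \<Rightarrow> bool" where
  "full_row_rank M \<longleftrightarrow> rank M = CARD('m)"

abbreviation cmat :: "real ^ 'n ^ 'm \<Rightarrow> complex ^ 'n ^ 'm" where
  "cmat \<equiv> map_matrix complex_of_real"

definition eigenvalue :: "complex ^ 'n ^ 'n \<Rightarrow> complex \<Rightarrow> bool" where
  "eigenvalue M z \<longleftrightarrow> (\<exists>v. v \<noteq> 0 \<and> M *v v = z *s v)"

definition schur_stable :: "real ^ 'n ^ 'n \<Rightarrow> bool" where
  "schur_stable M \<longleftrightarrow> (\<forall>z. eigenvalue (cmat M) z \<longrightarrow> cmod z < 1)"

definition stabilizable :: "real ^ 'x ^ 'x \<Rightarrow> real ^ 'u ^ 'x \<Rightarrow> bool" where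
  "stabilizable A B \<longleftrightarrow> (\<exists>F. schur_stable (A + B ** F))"

definition stabilizing_gains ::
  "real ^ 'x ^ 'x \<Rightarrow> real ^ 'u ^ 'x \<Rightarrow> real ^ 'x ^ 'y \<Rightarrow> (real ^ 'y ^ 'u) set" where
  "stabilizing_gains A B C = {K. schur_stable (A + B ** K ** C)}"

definition conj_transpose :: "complex ^ 'n ^ 'm \<Rightarrow> complex ^ 'm ^ 'n" where
  "conj_transpose M = map_matrix cnj (transpose M)"

definition singular_values :: "complex ^ 'n ^ 'm \<Rightarrow> real set" where
  "singular_values M = {s. s \<ge> 0 \<and> eigenvalue (conj_transpose M ** M) (of_real (s\<^sup>2))}"

(* The set is finite and nonempty, so the supremum is the largest singular value. *)
definition sigma_max :: "complex ^ 'n ^ 'm \<Rightarrow> real" where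
  "sigma_max M = Sup (singular_values M)"

(* vertical block matrix [M; N] *)
definition vstack :: "'a ^ 'n ^ 'm \<Rightarrow> 'a ^ 'n ^ 'k \<Rightarrow> 'a ^ 'n ^ ('m + 'k)" where
  "vstack M N = (\<chi> i. case i of Inl a \<Rightarrow> M $ a | Inr b \<Rightarrow> N $ b)"

definition T_zw ::
  "real ^ 'x ^ 'x \<Rightarrow> real ^ 'u ^ 'x \<Rightarrow> real ^ 'w ^ 'x \<Rightarrow> real ^ 'x ^ 'y \<Rightarrow>
   real ^ 'x ^ 'x \<Rightarrow> real ^ 'u ^ 'u \<Rightarrow> real ^ 'y ^ 'u \<Rightarrow> real \<Rightarrow> complex ^ 'w ^ ('x + 'u)" where
  "T_zw A B Bw C Q R K \<omega> =
     cmat (vstack (psd_sqrt Q) (psd_sqrt R ** K ** C))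
     ** matrix_inv (mat (cis \<omega>) - cmat (A + B ** K ** C)) ** cmat Bw"

(* Meaningful for stabilizing K only; there the supremum is attained. *)
definition hinf_cost ::
  "real ^ 'x ^ 'x \<Rightarrow> real ^ 'u ^ 'x \<Rightarrow> real ^ 'w ^ 'x \<Rightarrow> real ^ 'x ^ 'y \<Rightarrow>
   real ^ 'x ^ 'x \<Rightarrow> real ^ 'u ^ 'u \<Rightarrow> real ^ 'y ^ 'u \<Rightarrow> real" where
  "hinf_cost A B Bw C Q R K = (SUP \<omega>\<in>{0..2 * pi}. sigma_max (T_zw A B Bw C Q R K \<omega>))"

definition frechet_subdiff :: "('a::real_inner \<Rightarrow> real) \<Rightarrow> 'a \<Rightarrow> 'a set" where
  "frechet_subdiff f x =
     {v. Liminf (at x) (\<lambda>y. ereal ((f y - f x - v \<bullet> (y - x)) / norm (y - x))) \<ge> 0}"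

definition weakly_convex_on :: "real \<Rightarrow> 'a::real_inner set \<Rightarrow> ('a \<Rightarrow> real) \<Rightarrow> bool" where
  "weakly_convex_on m U f \<longleftrightarrow> convex_on U (\<lambda>x. f x + m / 2 * (norm x)\<^sup>2)"

definition largest_ball_in :: "'a::metric_space set \<Rightarrow> 'a \<Rightarrow> 'a set" where
  "largest_ball_in S x = \<Union> {ball x r | r. ball x r \<subseteq> S}"

datatype model_kind = Full_Memory | Two_Cut | General

(* the affine function  X \<mapsto> J(Y) + m/2 |Y - Kt|^2 + <g, X - Y> *)
definition shifted_cut ::
  "('a::real_inner \<Rightarrow> real) \<Rightarrow> real \<Rightarrow> 'a \<Rightarrow> 'a \<Rightarrow> 'a \<Rightarrow> 'a \<Rightarrow> real" where
  "shifted_cut J m Kt Y g X = J Y + m / 2 * (norm (Y - Kt))\<^sup>2 + g \<bullet> (X - Y)"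

(* The k-th lower model, determined by the iterates L, the vectors G, the extra functions M and
   the kind of model used at each step.  The k-th model depends on L, G, M and kind only through
   their values at indices up to k; the kind at index 0 is irrelevant. *)
fun lower_model ::
  "('a::real_inner \<Rightarrow> real) \<Rightarrow> real \<Rightarrow> real \<Rightarrow> 'a \<Rightarrow> (nat \<Rightarrow> model_kind) \<Rightarrow> (nat \<Rightarrow> 'a \<Rightarrow> real) \<Rightarrow>
   (nat \<Rightarrow> 'a) \<Rightarrow> (nat \<Rightarrow> 'a) \<Rightarrow> nat \<Rightarrow> 'a \<Rightarrow> real" where
  "lower_model J m \<rho> Kt kind M L G 0 X = J (L 0) + G 0 \<bullet> (X - L 0)"
| "lower_model J m \<rho> Kt kind M L G (Suc k) X =
     (let new = shifted_cut J m Kt (L (Suc k)) (G (Suc k)) X;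
          agg = lower_model J m \<rho> Kt kind M L G k (L (Suc k))
                  + (\<rho> *\<^sub>R (Kt - L (Suc k))) \<bullet> (X - L (Suc k))
      in case kind (Suc k) of
           Full_Memory \<Rightarrow> (MAX i\<in>{0..Suc k}. shifted_cut J m Kt (L i) (G i) X)
         | Two_Cut \<Rightarrow> max new agg
         | General \<Rightarrow> max (M (Suc k) X) (max new agg))"

end

theory Submission
  imports Defs "HOL-Complex_Analysis.Conformal_Mappings"
begin

text \<open>
  Two facts carry the theorem. The ball of radius \<open>d\<close> around \<open>Kt\<close> lies in the interior of the larger
  sublevel set, with \<open>0 < d\<close>; and on that ball every model is Lipschitz with a constant smaller
  than \<open>\<rho> * d\<close>.

  The second fact is an induction along the iterates. As long as \<open>L 0, \<dots>, L n\<close> lie in the ball, the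
  subgradients of \<open>J\<close> at these points have norm at most \<open>l\<close> (lemma \<open>frechet_subdiff_norm_le\<close>), so a
  cut has slope less than \<open>l + m * d\<close>; an aggregate cut has slope \<open>\<rho> * norm (Kt - L i)\<close>, less than \<open>\<rho> * d\<close>
  by induction; and an extra model has slope at most \<open>lM\<close>. The lower bound on \<open>\<rho>\<close> says precisely that all
  these numbers are below \<open>\<rho> * d\<close>. At the minimizer \<open>X\<close> of a convex function plus the proximal term,
  \<open>\<rho> * (Kt - X)\<close> is a subgradient of that function, whence \<open>\<rho> * norm (X - Kt)\<close> is at most its
  Lipschitz constant and \<open>X\<close> stays in the ball (lemma \<open>proximal_step_in_ball\<close>).

  The first fact needs the analysis of the cost. Once the sublevel sets are closed and the cost is continuous
  on the open set of stabilizing gains, the cost equals \<open>2 * J K0\<close> on the frontier of the larger sublevel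
  set, so by the Lipschitz hypothesis this frontier is at distance at least \<open>J K0 / l\<close> from every
  gain whose cost is at most \<open>J K0\<close>. Here \<open>J K0\<close> is positive because it exceeds an infimum of nonnegative
  numbers, and the frontier is nonempty because a bound on the cost bounds the gain. The infimum that
  defines \<open>d\<close> is therefore positive.

  Closedness and the bound on the gain both come from the maximum modulus principle. In the variable
  \<open>\<zeta> = 1 / z\<close> the transfer matrix times \<open>z\<close> is analytic on the closed unit disc, so the cost bounds it there
  (lemma \<open>gain_bound_in_disc\<close>). At \<open>\<zeta> = 0\<close> this bounds the output matrix, hence \<open>K\<close>. For the other
  \<open>\<zeta>\<close> it bounds the resolvent outside the unit disc, since \<open>Q\<^sup>1\<^sup>/\<^sup>2\<close> is injective and \<open>Bw\<close> is
  surjective; such a bound survives limits and excludes eigenvalues of modulus at least 1.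
  Resolvent bounds thus replace every argument about the movement of eigenvalues.
\<close>

section \<open>Minimizers of convex models with a proximal term\<close>

text \<open>
  With \<open>X\<close> the minimizer and \<open>r = norm (X - a)\<close>, optimality and convexity give
  \<open>\<phi> a - \<phi> X \<ge> \<rho> * r\<^sup>2\<close>, while the Lipschitz bound gives at most \<open>c * r\<close>; so \<open>r \<le> c / \<rho> < d\<close>. The Lipschitz
  bound is only local, so the minimization is first done on a slightly smaller closed ball: its
  minimizer turns out to be an interior point, and strong convexity makes it the unique global one.
\<close>
lemma proximal_step_in_ball:
  fixes \<phi> :: "'a::euclidean_space \<Rightarrow> real"
  assumes conv: "convex_on UNIV \<phi>" and lip: "c-lipschitz_on (ball a d) \<phi>"
    and less: "c < \<rho> * d" and "0 < d"
  shows "\<exists>X0. (\<forall>X. is_arg_min (\<lambda>X. \<phi> X + \<rho> / 2 * (norm (X - a))\<^sup>2) (\<lambda>_. True) X \<longleftrightarrow> X = X0)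
            \<and> norm (X0 - a) < d"
proof -
  define F where "F X = \<phi> X + \<rho> / 2 * (norm (X - a))\<^sup>2" for X
  have "c \<ge> 0" using lip by (simp add: lipschitz_on_def)
  then have "0 < \<rho>" using less \<open>0 < d\<close> by (smt (verit) mult_nonpos_nonneg)
  have "c / \<rho> < d" using less \<open>0 < \<rho>\<close> by (simp add: field_simps)
  then obtain e where e: "c / \<rho> < e" "e < d" using dense by blast
  have "0 \<le> c / \<rho>" using \<open>c \<ge> 0\<close> \<open>0 < \<rho>\<close> by simp
  then have "0 < e" using e by linarith
  have F_convex: "F (x + t *\<^sub>R (y - x)) \<le> (1 - t) * F x + t * F y - \<rho> / 2 * (t * (1 - t) * (norm (y - x))\<^sup>2)"
    if "0 < t" "t < 1" for x y t
  proof -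
    have eq: "x + t *\<^sub>R (y - x) = (1 - t) *\<^sub>R x + t *\<^sub>R y" by (simp add: algebra_simps)
    have "\<phi> (x + t *\<^sub>R (y - x)) \<le> (1 - t) * \<phi> x + t * \<phi> y"
      using convex_onD[OF conv, of t x y] that unfolding eq by simp
    moreover have "(norm (p + t *\<^sub>R q))\<^sup>2
        = (1 - t) * (norm p)\<^sup>2 + t * (norm (p + q))\<^sup>2 - t * (1 - t) * (norm q)\<^sup>2" for p q :: 'a
      unfolding power2_norm_eq_inner by (simp add: inner_simps inner_commute algebra_simps)
    from this[of "x - a" "y - x"] have "(norm (x + t *\<^sub>R (y - x) - a))\<^sup>2
        = (1 - t) * (norm (x - a))\<^sup>2 + t * (norm (y - a))\<^sup>2 - t * (1 - t) * (norm (y - x))\<^sup>2"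
      by (simp add: algebra_simps)
    then have "\<rho> / 2 * (norm (x + t *\<^sub>R (y - x) - a))\<^sup>2
        = (1 - t) * (\<rho> / 2 * (norm (x - a))\<^sup>2) + t * (\<rho> / 2 * (norm (y - a))\<^sup>2)
          - \<rho> / 2 * (t * (1 - t) * (norm (y - x))\<^sup>2)"
      by (simp only:) (simp add: field_simps)
    ultimately show ?thesis unfolding F_def distrib_left by linarith
  qed
  have "cball a e \<subseteq> ball a d" using e by auto
  then have "continuous_on (cball a e) \<phi>"
    by (rule continuous_on_subset[OF lipschitz_on_continuous_on[OF lip]])
  then have "continuous_on (cball a e) F"
    unfolding F_def by (intro continuous_intros)
  then obtain X where X: "X \<in> cball a e" and min: "\<And>Y. Y \<in> cball a e \<Longrightarrow> F X \<le> F Y"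
    using continuous_attains_inf[OF compact_cball, of a e F] \<open>0 < e\<close> by force
  \<comment> \<open>Quadratic growth around a minimizer over the closed ball, used for \<open>Y = a\<close> and then for arbitrary \<open>Y\<close>.\<close>
  have growth: "F X + \<rho> / 2 * ((1 - t) * (norm (Y - X))\<^sup>2) \<le> F Y"
    if t: "0 < t" "t < 1" and "X + t *\<^sub>R (Y - X) \<in> cball a e" for Y t
  proof -
    have "F X \<le> (1 - t) * F X + t * F Y - \<rho> / 2 * (t * (1 - t) * (norm (Y - X))\<^sup>2)"
      using F_convex[OF t, of X Y] min[OF that(3)] by linarith
    then have "t * (F X + \<rho> / 2 * ((1 - t) * (norm (Y - X))\<^sup>2)) \<le> t * F Y"
      by (simp add: algebra_simps)
    then show ?thesis using t by simp
  qed
  define r where "r = norm (X - a)"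
  have "r \<le> e" using X by (simp add: r_def dist_norm norm_minus_commute)
  have "\<rho> * r \<le> c"
  proof (rule ccontr)
    assume "\<not> \<rho> * r \<le> c"
    then have *: "c < \<rho> * r" by simp
    then have "0 < r" using \<open>c \<ge> 0\<close> \<open>0 < \<rho>\<close> by (smt (verit) mult_nonneg_nonpos)
    \<comment> \<open>Any \<open>t\<close> in \<open>{0<..1}\<close> with \<open>t * (\<rho> * r) \<le> \<rho> * r - c\<close> serves: the segment estimate at \<open>t / 2\<close> costs only a quarter of that gap.\<close>
    define t where "t = (\<rho> * r - c) / (\<rho> * r + c)"
    have t: "0 < t" "t \<le> 1" using * \<open>c \<ge> 0\<close> by (auto simp: t_def)
    have seg: "X + s *\<^sub>R (a - X) \<in> cball a e" if "0 \<le> s" "s \<le> 1" for s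
    proof -
      have "a - (X + s *\<^sub>R (a - X)) = (1 - s) *\<^sub>R (a - X)" by (simp add: algebra_simps)
      then have "norm (a - (X + s *\<^sub>R (a - X))) = (1 - s) * r"
        using that by (simp add: r_def norm_minus_commute)
      moreover have "(1 - s) * r \<le> 1 * r" using that \<open>0 < r\<close> by (intro mult_right_mono) auto
      ultimately show ?thesis using \<open>r \<le> e\<close> by (simp add: dist_norm)
    qed
    have "F X + \<rho> / 2 * ((1 - t / 2) * (norm (a - X))\<^sup>2) \<le> F a"
      using growth[of "t / 2" a] seg[of "t / 2"] t by simp
    moreover have "\<phi> a - \<phi> X \<le> c * r"
      using lipschitz_onD[OF lip, of a X] X e \<open>0 < d\<close> by (simp add: dist_norm r_def norm_minus_commute)
    ultimately have "\<rho> / 2 * r\<^sup>2 + \<rho> / 2 * ((1 - t / 2) * r\<^sup>2) \<le> c * r"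
      by (simp add: F_def r_def norm_minus_commute)
    then have "r * (\<rho> / 2 * r + \<rho> / 2 * ((1 - t / 2) * r)) \<le> r * c"
      by (simp add: power2_eq_square algebra_simps)
    then have "\<rho> / 2 * r + \<rho> / 2 * ((1 - t / 2) * r) \<le> c"
      using \<open>0 < r\<close> by (simp only: mult_le_cancel_left_pos)
    then have "\<rho> * r * (1 - t / 4) \<le> c" by (simp add: algebra_simps)
    moreover have "t * (\<rho> * r) \<le> \<rho> * r - c"
    proof -
      have "\<rho> * r / (\<rho> * r + c) \<le> 1" using * \<open>c \<ge> 0\<close> by simp
      then have "(\<rho> * r - c) * (\<rho> * r / (\<rho> * r + c)) \<le> (\<rho> * r - c) * 1"
        using * by (intro mult_left_mono) auto
      then show ?thesis by (simp add: t_def)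
    qed
    moreover have "\<rho> * r * (1 - t / 4) = \<rho> * r - t * (\<rho> * r) / 4" by (simp add: algebra_simps)
    ultimately show False using * by linarith
  qed
  then have "r \<le> c / \<rho>" using \<open>0 < \<rho>\<close> by (simp add: field_simps)
  then have "r < e" using e by linarith
  have strict: "F X < F Y" if "Y \<noteq> X" for Y
  proof -
    define t where "t = min (1/2) ((e - r) / norm (Y - X))"
    have t: "0 < t" "t < 1" using \<open>r < e\<close> that by (auto simp: t_def)
    have "t * norm (Y - X) \<le> e - r"
    proof -
      have "t \<le> (e - r) / norm (Y - X)" by (simp add: t_def)
      then show ?thesis using that by (simp add: pos_le_divide_eq)
    qed
    then have "norm ((X - a) + t *\<^sub>R (Y - X)) \<le> e"
      using norm_triangle_ineq[of "X - a" "t *\<^sub>R (Y - X)"] t by (simp add: r_def)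
    moreover have "X + t *\<^sub>R (Y - X) - a = (X - a) + t *\<^sub>R (Y - X)" by simp
    ultimately have "norm (X + t *\<^sub>R (Y - X) - a) \<le> e" by (simp only:)
    then have "X + t *\<^sub>R (Y - X) \<in> cball a e"
      by (simp add: dist_norm norm_minus_commute[of a])
    then have "F X + \<rho> / 2 * ((1 - t) * (norm (Y - X))\<^sup>2) \<le> F Y" by (rule growth[OF t])
    moreover have "0 < \<rho> / 2 * ((1 - t) * (norm (Y - X))\<^sup>2)" using t that \<open>0 < \<rho>\<close> by simp
    ultimately show ?thesis by linarith
  qed
  have "is_arg_min F (\<lambda>_. True) Z \<longleftrightarrow> Z = X" for Z
    unfolding is_arg_min_def using strict by (metis less_irrefl less_asym)
  moreover have "r < d" using \<open>r < e\<close> e by linarith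
  ultimately show ?thesis unfolding F_def r_def by blast
qed

text \<open>
  Moving from \<open>x\<close> in the direction of \<open>v\<close> itself, \<open>f\<close> must grow at rate nearly \<open>norm v\<close>, but it
  grows at rate at most \<open>c\<close>.
\<close>
lemma frechet_subdiff_norm_le:
  fixes f :: "'a::real_inner \<Rightarrow> real"
  assumes lip: "c-lipschitz_on S f" and x: "x \<in> interior S" and v: "v \<in> frechet_subdiff f x"
  shows "norm v \<le> c"
proof (rule ccontr)
  assume "\<not> norm v \<le> c"
  then have less: "c < norm v" by simp
  have "c \<ge> 0" using lip by (simp add: lipschitz_on_def)
  then have "v \<noteq> 0" using less by auto
  let ?q = "\<lambda>y. (f y - f x - v \<bullet> (y - x)) / norm (y - x)"
  have "\<forall>\<^sub>F y in at x. ereal (c - norm v) < ereal (?q y)"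
    using v less unfolding frechet_subdiff_def le_Liminf_iff
    by (auto dest!: spec[of _ "ereal (c - norm v)"])
  then obtain \<delta> where "\<delta> > 0" and q: "\<And>y. y \<noteq> x \<Longrightarrow> dist y x < \<delta> \<Longrightarrow> c - norm v < ?q y"
    unfolding eventually_at by auto
  obtain e where "e > 0" and e: "ball x e \<subseteq> S" using x by (auto simp: mem_interior)
  \<comment> \<open>Small enough for \<open>y\<close> to lie both in \<open>S\<close> and in the range where the difference quotient is controlled.\<close>
  define t where "t = min \<delta> e / (2 * norm v)"
  have "t > 0" using \<open>\<delta> > 0\<close> \<open>e > 0\<close> \<open>v \<noteq> 0\<close> by (simp add: t_def)
  define y where "y = x + t *\<^sub>R v"
  have tn: "t * norm v = min \<delta> e / 2" using \<open>v \<noteq> 0\<close> by (simp add: t_def)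
  have dy: "dist y x = t * norm v" using \<open>t > 0\<close> by (simp add: y_def dist_norm)
  have "y \<noteq> x" using \<open>t > 0\<close> \<open>v \<noteq> 0\<close> by (simp add: y_def)
  have "c - norm v < ?q y" using q[OF \<open>y \<noteq> x\<close>] dy tn \<open>\<delta> > 0\<close> \<open>e > 0\<close> by simp
  then have "(c - norm v) * (t * norm v) < f y - f x - v \<bullet> (y - x)"
    using \<open>t > 0\<close> \<open>v \<noteq> 0\<close> by (simp add: y_def field_simps)
  moreover have "v \<bullet> (y - x) = norm v * (t * norm v)"
    by (simp add: y_def dot_square_norm power2_eq_square)
  moreover have "f y - f x \<le> c * (t * norm v)"
  proof -
    have "y \<in> S" using e dy tn \<open>\<delta> > 0\<close> \<open>e > 0\<close> by (auto simp: dist_commute subset_iff)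
    moreover have "x \<in> S" using x interior_subset by blast
    ultimately show ?thesis using lipschitz_onD[OF lip, of y x] dy by (simp add: dist_norm)
  qed
  ultimately show False by (simp add: algebra_simps)
qed

text \<open>
  The Lipschitz constant is existential so that the property is closed under maxima and a
  single strict bound \<open>b\<close> serves all pieces of a model.
\<close>
definition convex_lipschitz_below :: "real \<Rightarrow> 'a::real_normed_vector set \<Rightarrow> ('a \<Rightarrow> real) \<Rightarrow> bool" where
  "convex_lipschitz_below b S \<phi> \<longleftrightarrow> convex_on UNIV \<phi> \<and> (\<exists>c<b. c-lipschitz_on S \<phi>)"

lemma convex_lipschitz_below_affine:
  fixes g :: "'a::real_inner"
  assumes "norm g < b"
  shows "convex_lipschitz_below b S (\<lambda>X. c + g \<bullet> (X - y))"
proof -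
  have "convex_on UNIV (\<lambda>X. c + g \<bullet> (X - y))"
    by (rule convex_onI) (simp_all add: inner_simps algebra_simps)
  moreover have "(norm g)-lipschitz_on S (\<lambda>X. c + g \<bullet> (X - y))"
    using Cauchy_Schwarz_ineq2
    by (intro lipschitz_onI) (simp_all add: dist_norm flip: inner_diff_right)
  ultimately show ?thesis using assms unfolding convex_lipschitz_below_def by blast
qed

lemma convex_lipschitz_below_max:
  assumes "convex_lipschitz_below b S f" "convex_lipschitz_below b S g"
  shows "convex_lipschitz_below b S (\<lambda>X. max (f X) (g X))"
proof -
  obtain c1 c2 where c: "c1 < b" "c2 < b" "c1-lipschitz_on S f" "c2-lipschitz_on S g"
    using assms unfolding convex_lipschitz_below_def by blast
  have "(max c1 c2)-lipschitz_on S (\<lambda>X. max (f X) (g X))"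
  proof (rule lipschitz_onI)
    fix x y assume xy: "x \<in> S" "y \<in> S"
    have "c1 * dist x y \<le> max c1 c2 * dist x y" "c2 * dist x y \<le> max c1 c2 * dist x y"
      by (simp_all add: mult_right_mono)
    then show "dist (max (f x) (g x)) (max (f y) (g y)) \<le> max c1 c2 * dist x y"
      using lipschitz_onD[OF c(3) xy] lipschitz_onD[OF c(4) xy] by (auto simp: dist_real_def max_def)
  next
    show "0 \<le> max c1 c2" using c(3) by (simp add: lipschitz_on_def le_max_iff_disj)
  qed
  moreover have "convex_on UNIV (\<lambda>X. max (f X) (g X))"
  proof (rule convex_onI)
    fix t :: real and x y
    assume t: "0 < t" "t < 1"
    have "f ((1 - t) *\<^sub>R x + t *\<^sub>R y) \<le> (1 - t) * f x + t * f y"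
      "g ((1 - t) *\<^sub>R x + t *\<^sub>R y) \<le> (1 - t) * g x + t * g y"
      using assms t convex_onD[of UNIV f t x y] convex_onD[of UNIV g t x y]
      unfolding convex_lipschitz_below_def by auto
    moreover have "(1 - t) * f x + t * f y \<le> (1 - t) * max (f x) (g x) + t * max (f y) (g y)"
      "(1 - t) * g x + t * g y \<le> (1 - t) * max (f x) (g x) + t * max (f y) (g y)"
      using t by (auto intro!: add_mono mult_left_mono)
    ultimately show "max (f ((1 - t) *\<^sub>R x + t *\<^sub>R y)) (g ((1 - t) *\<^sub>R x + t *\<^sub>R y))
        \<le> (1 - t) * max (f x) (g x) + t * max (f y) (g y)"
      by linarith
  qed simp
  ultimately show ?thesis using c unfolding convex_lipschitz_below_def by (meson max_less_iff_conj)
qed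

lemma convex_lipschitz_below_Max:
  assumes "finite I" "I \<noteq> {}" "\<And>i. i \<in> I \<Longrightarrow> convex_lipschitz_below b S (f i)"
  shows "convex_lipschitz_below b S (\<lambda>X. MAX i\<in>I. f i X)"
  using assms
proof (induction I rule: finite_ne_induct)
  case (insert i I)
  then show ?case
    using convex_lipschitz_below_max[of b S "f i" "\<lambda>X. MAX i\<in>I. f i X"] by simp
qed simp

text \<open>
  A model is a maximum of affine functions and of the extra function, and the values of the models at
  the iterates enter only as constants. Hence its Lipschitz constant is governed by the slopes alone.
\<close>
lemma lower_model_convex_lipschitz_below:
  fixes Kt :: "'a::real_inner"
  assumes G: "\<And>i. i \<le> k \<Longrightarrow> norm (G i) < b"
    and agg: "\<And>i. 1 \<le> i \<Longrightarrow> i \<le> k \<Longrightarrow> norm (\<rho> *\<^sub>R (Kt - L i)) < b"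
    and M: "\<And>i. 1 \<le> i \<Longrightarrow> i \<le> k \<Longrightarrow> kind i = General \<Longrightarrow> convex_lipschitz_below b S (M i)"
  shows "convex_lipschitz_below b S (lower_model J m \<rho> Kt kind M L G k)"
proof (cases k)
  case 0
  have "lower_model J m \<rho> Kt kind M L G k = (\<lambda>X. J (L 0) + G 0 \<bullet> (X - L 0))"
    unfolding 0 by auto
  then show ?thesis using G[of 0] by (simp add: convex_lipschitz_below_affine)
next
  case (Suc n)
  let ?cut = "\<lambda>i. shifted_cut J m Kt (L i) (G i)"
  let ?agg = "\<lambda>X. lower_model J m \<rho> Kt kind M L G n (L k) + (\<rho> *\<^sub>R (Kt - L k)) \<bullet> (X - L k)"
  have cut: "convex_lipschitz_below b S (?cut i)" if "i \<le> k" for i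
    unfolding shifted_cut_def using convex_lipschitz_below_affine[OF G[OF that]] by blast
  have aggr: "convex_lipschitz_below b S ?agg"
    using convex_lipschitz_below_affine[OF agg[of k]] Suc by simp
  show ?thesis
  proof (cases "kind k")
    case Full_Memory
    then have "lower_model J m \<rho> Kt kind M L G k = (\<lambda>X. MAX i\<in>{0..k}. ?cut i X)"
      unfolding Suc by (intro ext) (simp only: lower_model.simps Let_def model_kind.case)
    then show ?thesis using convex_lipschitz_below_Max[of "{0..k}", OF _ _ cut] by simp
  next
    case Two_Cut
    then have "lower_model J m \<rho> Kt kind M L G k = (\<lambda>X. max (?cut k X) (?agg X))"
      unfolding Suc by (intro ext) (simp only: lower_model.simps Let_def model_kind.case)
    then show ?thesis using convex_lipschitz_below_max[OF cut aggr, of k] by simp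
  next
    case General
    then have "lower_model J m \<rho> Kt kind M L G k = (\<lambda>X. max (M k X) (max (?cut k X) (?agg X)))"
      unfolding Suc by (intro ext) (simp only: lower_model.simps Let_def model_kind.case)
    then show ?thesis
      using convex_lipschitz_below_max[OF M convex_lipschitz_below_max[OF cut aggr], of k k] General Suc
      by simp
  qed
qed

section \<open>Square roots of positive definite matrices\<close>

text \<open>
  A maximizer of the quadratic form on the unit sphere is an eigenvector: the form minus \<open>\<mu>\<close> times the
  squared norm is nonpositive everywhere and vanishes at \<open>v\<close>, so its derivative at \<open>v\<close> vanishes.
\<close>
lemma self_adjoint_max_eigenvector:
  fixes f :: "'a::euclidean_space \<Rightarrow> 'a"
  assumes "linear f" and adj: "\<And>x y. f x \<bullet> y = x \<bullet> f y"
  obtains v \<mu> where "norm v = 1" "f v = \<mu> *\<^sub>R v" "\<And>x. x \<bullet> f x \<le> \<mu> * (x \<bullet> x)"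
proof -
  interpret linear f by fact
  have cont: "continuous_on S f" for S by (simp add: linear_continuous_on linear_conv_bounded_linear \<open>linear f\<close> flip: linear_conv_bounded_linear)
  obtain b :: 'a where "b \<in> Basis" using nonempty_Basis by blast
  then have "sphere (0::'a) 1 \<noteq> {}" using norm_Basis by fastforce
  moreover have "continuous_on (sphere 0 1) (\<lambda>x. x \<bullet> f x)"
    by (intro continuous_intros cont)
  ultimately obtain v where v: "norm v = 1" and max: "\<And>x. norm x = 1 \<Longrightarrow> x \<bullet> f x \<le> v \<bullet> f v"
    using continuous_attains_sup[of "sphere (0::'a) 1" "\<lambda>x. x \<bullet> f x"] by auto
  define \<mu> where "\<mu> = v \<bullet> f v"
  have bound: "x \<bullet> f x \<le> \<mu> * (x \<bullet> x)" for x
  proof (cases "x = 0")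
    case False
    have "(x /\<^sub>R norm x) \<bullet> f (x /\<^sub>R norm x) \<le> \<mu>"
      unfolding \<mu>_def using False by (intro max) simp
    then have "(x \<bullet> f x) / (norm x)\<^sup>2 \<le> \<mu>"
      by (simp add: scale power2_eq_square divide_inverse algebra_simps)
    then show ?thesis using False by (simp add: divide_le_eq power2_norm_eq_inner)
  qed simp
  have stationary: "w \<bullet> (f v - \<mu> *\<^sub>R v) = 0" for w
  proof -
    define p where "p = w \<bullet> (f v - \<mu> *\<^sub>R v)"
    define q where "q = \<mu> * (w \<bullet> w) - w \<bullet> f w"
    have "2 * t * p \<le> t\<^sup>2 * q" for t
      using bound[of "v + t *\<^sub>R w"] v adj[of v w]
      by (simp add: p_def q_def \<mu>_def add scale inner_simps inner_commute algebra_simps power2_eq_square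
           norm_eq_1)
    then have ineq: "2 * t * p \<le> t\<^sup>2 * \<bar>q\<bar>" for t
      by (smt (verit) mult_left_mono zero_le_power2)
    show ?thesis
    proof (rule ccontr)
      assume "w \<bullet> (f v - \<mu> *\<^sub>R v) \<noteq> 0"
      then have "p \<noteq> 0" by (simp add: p_def)
      \<comment> \<open>A small step in the direction of growth makes the linear term win.\<close>
      let ?t = "p / (1 + \<bar>q\<bar>)"
      have "2 * p\<^sup>2 / (1 + \<bar>q\<bar>) \<le> p\<^sup>2 / (1 + \<bar>q\<bar>) * (\<bar>q\<bar> / (1 + \<bar>q\<bar>))"
        using ineq[of ?t] by (simp add: power2_eq_square)
      also have "\<dots> \<le> p\<^sup>2 / (1 + \<bar>q\<bar>) * 1"
        by (intro mult_left_mono) auto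
      finally have "p\<^sup>2 / (1 + \<bar>q\<bar>) \<le> 0" by simp
      moreover have "p\<^sup>2 / (1 + \<bar>q\<bar>) > 0" using \<open>p \<noteq> 0\<close> by simp
      ultimately show False by simp
    qed
  qed
  have "f v - \<mu> *\<^sub>R v = 0" using stationary[of "f v - \<mu> *\<^sub>R v"] by simp
  then show thesis using that[of v \<mu>] v bound by simp
qed

text \<open>
  For \<open>D = S - T\<close> equality of the squares gives \<open>S D + D T = 0\<close>. If \<open>v\<close> is an eigenvector of \<open>D\<close>, its
  eigenvalue \<open>\<mu>\<close> satisfies \<open>\<mu> * (v \<bullet> S v + v \<bullet> T v) = 0\<close>; as both forms are nonnegative and
  \<open>\<mu>\<close> is their difference, \<open>\<mu> = 0\<close>. Taking the top eigenvector bounds the form of \<open>D\<close>.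
\<close>
lemma psd_root_difference_nonpos:
  fixes S T :: "'a::euclidean_space \<Rightarrow> 'a"
  assumes "linear S" "linear T"
    and adjS: "\<And>x y. S x \<bullet> y = x \<bullet> S y" and adjT: "\<And>x y. T x \<bullet> y = x \<bullet> T y"
    and S0: "\<And>x. 0 \<le> x \<bullet> S x" and T0: "\<And>x. 0 \<le> x \<bullet> T x"
    and eq: "\<And>x. S (S x) = T (T x)"
  shows "x \<bullet> (S x - T x) \<le> 0"
proof -
  have "linear (\<lambda>x. S x - T x)" using assms(1,2) by (rule linear_compose_sub)
  moreover have "(S x - T x) \<bullet> y = x \<bullet> (S y - T y)" for x y by (simp add: inner_simps adjS adjT)
  ultimately obtain v \<mu> where v: "norm v = 1" and ev: "S v - T v = \<mu> *\<^sub>R v"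
      and max: "\<And>x. x \<bullet> (S x - T x) \<le> \<mu> * (x \<bullet> x)"
    using self_adjoint_max_eigenvector[of "\<lambda>x. S x - T x"] by blast
  have "v \<bullet> S (S v - T v) + v \<bullet> (S (T v) - T (T v)) = 0"
    using eq[of v] by (simp add: linear_diff[OF assms(1)] inner_simps)
  moreover have "v \<bullet> S (S v - T v) = \<mu> * (v \<bullet> S v)"
    by (simp add: ev linear_cmul[OF assms(1)])
  moreover have "v \<bullet> (S (T v) - T (T v)) = (S v - T v) \<bullet> T v"
    by (simp add: inner_simps adjS adjT)
  then have "v \<bullet> (S (T v) - T (T v)) = \<mu> * (v \<bullet> T v)"
    by (simp add: ev)
  ultimately have "\<mu> * (v \<bullet> S v + v \<bullet> T v) = 0"
    by (simp add: algebra_simps)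
  moreover have "\<mu> = v \<bullet> S v - v \<bullet> T v"
    using arg_cong[OF ev, of "\<lambda>w. v \<bullet> w"] v by (simp add: inner_simps norm_eq_1)
  ultimately have "\<mu> = 0" using S0[of v] T0[of v] by auto
  then show ?thesis using max[of x] by simp
qed

lemma psd_root_unique:
  fixes S T :: "'a::euclidean_space \<Rightarrow> 'a"
  assumes lin: "linear S" "linear T"
    and adj: "\<And>x y. S x \<bullet> y = x \<bullet> S y" "\<And>x y. T x \<bullet> y = x \<bullet> T y"
    and nonneg: "\<And>x. 0 \<le> x \<bullet> S x" "\<And>x. 0 \<le> x \<bullet> T x"
    and eq: "\<And>x. S (S x) = T (T x)"
  shows "S = T"
proof
  fix x
  define D where "D x = S x - T x" for x
  have D: "y \<bullet> D y = 0" for y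
    using psd_root_difference_nonpos[OF lin adj nonneg eq, of y]
      psd_root_difference_nonpos[OF lin(2,1) adj(2,1) nonneg(2,1) eq[symmetric], of y]
    by (simp add: D_def inner_simps)
  have lD: "linear D" unfolding D_def using lin by (rule linear_compose_sub)
  have "D x \<bullet> y = x \<bullet> D y" for y by (simp add: D_def inner_diff_left inner_diff_right adj)
  then have "D x \<bullet> D x = x \<bullet> D (D x)" by blast
  moreover have "(x + D x) \<bullet> D (x + D x) = x \<bullet> D x + x \<bullet> D (D x) + D x \<bullet> D x + D x \<bullet> D (D x)"
    unfolding linear_add[OF lD] inner_add_left inner_add_right by simp
  ultimately have "D x \<bullet> D x = 0"
    using D[of "x + D x"] D[of x] D[of "D x"] by linarith
  then show "S x = T x" by (simp add: D_def)
qed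

text \<open>
  After scaling by \<open>c\<close>, \<open>f / c = id - g\<close> with \<open>norm g \<le> q < 1\<close>. A root \<open>id - Y\<close> of \<open>id - g\<close> is the same
  as a fixed point of \<open>Y \<mapsto> (g + Y Y) / 2\<close>, and this map is a contraction with factor \<open>q\<close> of the
  self-adjoint operators of norm at most \<open>q\<close>.
\<close>
lemma positive_root_exists:
  fixes f :: "'a::euclidean_space \<Rightarrow>\<^sub>L 'a"
  assumes adj: "\<And>x y. f x \<bullet> y = x \<bullet> f y" and pos: "\<And>x. x \<noteq> 0 \<Longrightarrow> 0 < x \<bullet> f x"
  obtains s :: "'a \<Rightarrow>\<^sub>L 'a" where "\<And>x y. s x \<bullet> y = x \<bullet> s y" "\<And>x. 0 \<le> x \<bullet> s x" "s o\<^sub>L s = f"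
proof -
  have "linear (\<lambda>x. - f x)"
    by (intro linear_compose_neg bounded_linear.linear blinfun.bounded_linear_right)
  moreover have "- f x \<bullet> y = x \<bullet> - f y" for x y by (simp add: adj)
  ultimately obtain v \<mu> where v: "norm v = 1" "- f v = \<mu> *\<^sub>R v" and max: "\<And>x. x \<bullet> - f x \<le> \<mu> * (x \<bullet> x)"
    using self_adjoint_max_eigenvector[of "\<lambda>x. - f x"] by blast
  define \<alpha> where "\<alpha> = - \<mu>"
  have "f v = \<alpha> *\<^sub>R v" using v(2) by (simp add: \<alpha>_def) (metis minus_minus)
  then have "\<alpha> = v \<bullet> f v" using v(1) by (simp add: norm_eq_1)
  then have "\<alpha> > 0" using pos[of v] v(1) by (cases "v = 0") simp_all
  have lower: "\<alpha> * (norm x)\<^sup>2 \<le> x \<bullet> f x" for x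
    using max[of x] by (simp add: \<alpha>_def power2_norm_eq_inner)
  define N where "N = norm f"
  have "\<alpha> \<le> N"
    using norm_blinfun[of f v] \<open>f v = \<alpha> *\<^sub>R v\<close> v(1) \<open>\<alpha> > 0\<close> by (simp add: N_def)
  then have "N > 0" using \<open>\<alpha> > 0\<close> by simp
  \<comment> \<open>This \<open>c\<close> minimizes the bound \<open>1 - 2 * \<alpha> / c + N\<^sup>2 / c\<^sup>2\<close> on the squared norm of \<open>id - f / c\<close>.\<close>
  define c where "c = N\<^sup>2 / \<alpha>"
  have "c > 0" using \<open>N > 0\<close> \<open>\<alpha> > 0\<close> by (simp add: c_def)
  define g where "g = id_blinfun - (1 / c) *\<^sub>R f"
  define q where "q = sqrt (1 - \<alpha>\<^sup>2 / N\<^sup>2)"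
  have "\<alpha>\<^sup>2 / N\<^sup>2 \<le> 1" using \<open>\<alpha> \<le> N\<close> \<open>\<alpha> > 0\<close> by (simp add: divide_le_eq power_mono)
  then have q2: "q\<^sup>2 = 1 - \<alpha>\<^sup>2 / N\<^sup>2" "0 \<le> q" by (simp_all add: q_def)
  have "q < 1" using \<open>\<alpha> > 0\<close> \<open>N > 0\<close> by (simp add: q_def real_sqrt_lt_1_iff)
  have "norm g \<le> q"
  proof (rule norm_blinfun_bound)
    fix x
    have "(norm (f x))\<^sup>2 \<le> (N * norm x)\<^sup>2"
      using norm_blinfun[of f x] by (intro power_mono) (simp_all add: N_def)
    then have fx: "(norm (f x))\<^sup>2 / c\<^sup>2 \<le> (N * norm x)\<^sup>2 / c\<^sup>2" by (intro divide_right_mono) auto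
    have "(norm (x - k *\<^sub>R y))\<^sup>2 = (norm x)\<^sup>2 - 2 * k * (x \<bullet> y) + k\<^sup>2 * (norm y)\<^sup>2" for k y
      by (simp add: power2_norm_eq_inner inner_diff_left inner_diff_right inner_commute[of y x] power2_eq_square[of k] algebra_simps)
    from this[of "1 / c" "f x"]
    have "(norm (g x))\<^sup>2 = (norm x)\<^sup>2 - 2 / c * (x \<bullet> f x) + (norm (f x))\<^sup>2 / c\<^sup>2"
      by (simp add: g_def blinfun.bilinear_simps power_divide)
    also have "\<dots> \<le> (norm x)\<^sup>2 - 2 / c * (\<alpha> * (norm x)\<^sup>2) + (N * norm x)\<^sup>2 / c\<^sup>2"
      using fx mult_left_mono[OF lower[of x], of "2 / c"] \<open>c > 0\<close> by simp
    also have "\<dots> = (1 - \<alpha>\<^sup>2 / N\<^sup>2) * (norm x)\<^sup>2"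
      using \<open>N > 0\<close> \<open>\<alpha> > 0\<close> by (simp add: c_def field_simps power2_eq_square)
    also have "\<dots> = (q * norm x)\<^sup>2" by (simp add: q2 power_mult_distrib)
    finally show "norm (g x) \<le> q * norm x"
      by (rule power2_le_imp_le) (simp add: \<open>0 \<le> q\<close>)
  qed fact
  define U where "U = {Y :: 'a \<Rightarrow>\<^sub>L 'a. norm Y \<le> q \<and> (\<forall>x y. blinfun_apply Y x \<bullet> y = x \<bullet> blinfun_apply Y y)}"
  define h where "h Y = (1/2) *\<^sub>R (g + (Y o\<^sub>L Y))" for Y
  have "closed {Y :: 'a \<Rightarrow>\<^sub>L 'a. norm Y \<le> q}"
    by (intro closed_Collect_le continuous_intros)
  moreover have "closed {Y :: 'a \<Rightarrow>\<^sub>L 'a. \<forall>x y. blinfun_apply Y x \<bullet> y = x \<bullet> blinfun_apply Y y}"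
    by (intro closed_Collect_all closed_Collect_eq continuous_intros)
  ultimately have "complete U"
    unfolding U_def complete_eq_closed by (simp add: closed_Collect_conj)
  moreover have "U \<noteq> {}" using \<open>0 \<le> q\<close> by (auto simp: U_def intro!: exI[of _ 0])
  moreover have "h ` U \<subseteq> U"
  proof
    fix Z assume "Z \<in> h ` U"
    then obtain Y where Z: "Z = h Y" and Y: "norm Y \<le> q" "\<And>x y. blinfun_apply Y x \<bullet> y = x \<bullet> blinfun_apply Y y"
      by (auto simp: U_def)
    have "norm (Y o\<^sub>L Y) \<le> q * q"
      using norm_blinfun_compose[of Y Y] Y(1) mult_mono[of "norm Y" q "norm Y" q] by simp
    also have "\<dots> \<le> q" using \<open>0 \<le> q\<close> \<open>q < 1\<close> by (simp add: mult_left_le)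
    finally have "norm (g + (Y o\<^sub>L Y)) \<le> 2 * q"
      using norm_triangle_ineq[of g "Y o\<^sub>L Y"] \<open>norm g \<le> q\<close> by linarith
    then have "norm Z \<le> q" by (simp add: Z h_def)
    then show "Z \<in> U"
      by (simp add: U_def Z h_def g_def blinfun.bilinear_simps inner_simps adj Y)
  qed
  moreover have "dist (h Y) (h Z) \<le> q * dist Y Z" if "Y \<in> U" "Z \<in> U" for Y Z
  proof -
    have "h Y - h Z = (1/2) *\<^sub>R ((Y o\<^sub>L (Y - Z)) + ((Y - Z) o\<^sub>L Z))"
      by (rule blinfun_eqI) (simp add: h_def blinfun.bilinear_simps algebra_simps)
    then have "norm (h Y - h Z) \<le> 1/2 * (norm Y * norm (Y - Z) + norm (Y - Z) * norm Z)"
      using norm_triangle_ineq[of "Y o\<^sub>L (Y - Z)" "(Y - Z) o\<^sub>L Z"]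
        norm_blinfun_compose[of Y "Y - Z"] norm_blinfun_compose[of "Y - Z" Z] by simp
    also have "\<dots> \<le> 1/2 * (q * norm (Y - Z) + norm (Y - Z) * q)"
      using that by (intro mult_left_mono add_mono mult_right_mono) (auto simp: U_def)
    finally show ?thesis by (simp add: dist_norm mult.commute)
  qed
  ultimately obtain Y where "Y \<in> U" and fixed: "h Y = Y"
    using Banach_fix[of U q h] \<open>0 \<le> q\<close> \<open>q < 1\<close> by metis
  have YY: "Y (Y x) = 2 *\<^sub>R Y x - g x" for x
  proof -
    have "2 *\<^sub>R Y x = 2 *\<^sub>R h Y x" by (simp add: fixed)
    also have "\<dots> = g x + Y (Y x)" by (simp add: h_def blinfun.bilinear_simps)
    finally show ?thesis by simp
  qed
  define s where "s = sqrt c *\<^sub>R (id_blinfun - Y)"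
  have "s x \<bullet> y = x \<bullet> s y" for x y
    using \<open>Y \<in> U\<close> by (simp add: s_def U_def blinfun.bilinear_simps inner_simps)
  moreover have "0 \<le> x \<bullet> s x" for x
  proof -
    have "norm Y * norm x \<le> 1 * norm x"
      using \<open>Y \<in> U\<close> \<open>q < 1\<close> by (intro mult_right_mono) (auto simp: U_def)
    then have "x \<bullet> Y x \<le> norm x * norm x"
      using Cauchy_Schwarz_ineq2[of x "Y x"] norm_blinfun[of Y x]
      by (smt (verit) mult_left_mono norm_ge_zero)
    then show ?thesis
      using \<open>c > 0\<close> by (simp add: s_def blinfun.bilinear_simps inner_simps flip: power2_norm_eq_inner)
        (simp add: power2_eq_square)
  qed
  moreover have "s o\<^sub>L s = f"
  proof (rule blinfun_eqI)
    fix x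
    have "s (s x) = (sqrt c * sqrt c) *\<^sub>R ((x - Y x) - (Y x - Y (Y x)))"
      unfolding scaleR_scaleR[symmetric]
      by (simp add: s_def blinfun.bilinear_simps flip: scaleR_right_diff_distrib)
    also have "sqrt c * sqrt c = c" using \<open>c > 0\<close> by simp
    also have "c *\<^sub>R ((x - Y x) - (Y x - Y (Y x))) = c *\<^sub>R (x - g x)"
      by (simp add: YY scaleR_2)
    also have "\<dots> = f x" using \<open>c > 0\<close> by (simp add: g_def blinfun.bilinear_simps)
    finally show "(s o\<^sub>L s) x = f x" by simp
  qed
  ultimately show thesis by (rule that)
qed

lemma transpose_eq_self_iff:
  fixes M :: "real ^ 'n ^ 'n"
  shows "transpose M = M \<longleftrightarrow> (\<forall>x y. (M *v x) \<bullet> y = x \<bullet> (M *v y))"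
proof
  assume "transpose M = M"
  then show "\<forall>x y. (M *v x) \<bullet> y = x \<bullet> (M *v y)"
    by (metis dot_lmul_matrix transpose_matrix_vector)
next
  assume *: "\<forall>x y. (M *v x) \<bullet> y = x \<bullet> (M *v y)"
  have "(transpose M *v x) \<bullet> y = (M *v x) \<bullet> y" for x y
    using * by (simp add: dot_lmul_matrix)
  then have "transpose M *v x = M *v x" for x
    by (metis vector_eq_rdot)
  then show "transpose M = M" by (simp add: matrix_eq)
qed

text \<open>
  The existence and the uniqueness of the root make the description in the definition of the square root
  proper.
\<close>
lemma psd_sqrt_square:
  assumes "pos_def Q"
  shows "psd_sqrt Q ** psd_sqrt Q = Q"
proof -
  have app: "blinfun_apply (Blinfun ((*v) Q)) = (*v) Q"
    by (simp add: bounded_linear_Blinfun_apply)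
  have "transpose Q = Q" and pos: "\<And>x. x \<noteq> 0 \<Longrightarrow> 0 < x \<bullet> (Q *v x)"
    using assms by (auto simp: pos_def_def)
  then have adj: "(Q *v x) \<bullet> y = x \<bullet> (Q *v y)" for x y
    by (simp add: transpose_eq_self_iff)
  obtain s where s: "\<And>x y. blinfun_apply s x \<bullet> y = x \<bullet> s y" "\<And>x. 0 \<le> x \<bullet> s x" "s o\<^sub>L s = Blinfun ((*v) Q)"
    using positive_root_exists[of "Blinfun ((*v) Q)"] adj pos unfolding app by blast
  define S where "S = matrix (blinfun_apply s)"
  have S: "S *v x = s x" for x
    unfolding S_def by (intro matrix_works) (simp only: linear_matrix_vector_mul_eq, intro bounded_linear.linear blinfun.bounded_linear_right)
  have root: "pos_semidef S" "S ** S = Q"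
  proof -
    show "pos_semidef S" by (simp add: pos_semidef_def transpose_eq_self_iff S s)
    show "S ** S = Q"
      using arg_cong[OF s(3), of blinfun_apply]
      by (simp add: matrix_eq S app fun_eq_iff flip: matrix_vector_mul_assoc)
  qed
  have "T = S" if "pos_semidef T" "T ** T = Q" for T
  proof -
    have "(*v) T = (*v) S"
    proof (rule psd_root_unique)
      show "(T *v (T *v x)) = S *v (S *v x)" for x
        using root that by (simp add: matrix_vector_mul_assoc)
    qed (use root(1) that(1) in \<open>auto simp: pos_semidef_def transpose_eq_self_iff\<close>)
    then show ?thesis by (simp add: matrix_eq fun_eq_iff)
  qed
  then have "psd_sqrt Q = S" unfolding psd_sqrt_def using root by (blast intro: the_equality)
  then show ?thesis using root(2) by (simp only:)
qed

lemma psd_sqrt_left_invertible: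
  assumes "pos_def Q"
  obtains S' where "S' ** psd_sqrt Q = mat 1"
proof -
  have "inj ((*v) Q)"
    using assms unfolding pos_def_def by (metis inner_zero_right less_irrefl vec.inj_iff_eq_0)
  then obtain Q' where "Q' ** Q = mat 1" using matrix_left_invertible_injective by blast
  then have "(Q' ** psd_sqrt Q) ** psd_sqrt Q = mat 1"
    using psd_sqrt_square[OF assms] by (simp flip: matrix_mul_assoc)
  then show thesis by (rule that)
qed

section \<open>The largest singular value as an operator norm\<close>

text \<open>
  Cauchy-Schwarz inequality in each row; the norm of a matrix is its Frobenius norm.
\<close>
lemma norm_matrix_vector_mult_le:
  fixes M :: "'a::real_normed_field ^ 'n ^ 'm"
  shows "norm (M *v x) \<le> norm M * norm x"
proof -
  have "norm ((M *v x) $ i) \<le> norm (M $ i) * norm x" for i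
  proof -
    have "norm ((M *v x) $ i) \<le> (\<Sum>j\<in>UNIV. norm (M $ i $ j * x $ j))"
      unfolding matrix_vector_mult_def by (simp add: norm_sum)
    also have "\<dots> = (\<Sum>j\<in>UNIV. \<bar>norm (M $ i $ j)\<bar> * \<bar>norm (x $ j)\<bar>)"
      by (simp add: norm_mult)
    also have "\<dots> \<le> norm (M $ i) * norm x"
      unfolding norm_vec_def by (rule L2_set_mult_ineq)
    finally show ?thesis .
  qed
  then have "norm (M *v x) \<le> L2_set (\<lambda>i. norm x * norm (M $ i)) UNIV"
    unfolding norm_vec_def[of "M *v x"] by (intro L2_set_mono) (auto simp: mult.commute)
  also have "\<dots> = norm M * norm x"
    by (simp add: norm_vec_def[of M] mult.commute flip: L2_set_right_distrib)
  finally show ?thesis .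
qed

text \<open>
  The inner product on complex vectors is the real part of the Hermitian one, so the conjugate
  transpose is an adjoint for it. This puts \<open>M\<^sup>* M\<close> within reach of the eigenvector lemma for real inner
  product spaces.
\<close>
lemma inner_adjoint_matrix:
  fixes M :: "complex ^ 'n ^ 'm"
  shows "(M *v x) \<bullet> y = x \<bullet> (conj_transpose M *v y)"
proof -
  have "inner (a * b) c = inner b (cnj a * c)" for a b c :: complex
    by (simp add: inner_complex_def algebra_simps)
  then show ?thesis
    unfolding inner_vec_def matrix_vector_mult_def conj_transpose_def
    by (simp add: inner_sum_left inner_sum_right transpose_def) (rule sum.swap)
qed

lemma of_real_scalar_mult: "of_real r *s (v :: complex ^ 'n) = r *\<^sub>R v"
  by (simp add: vec_eq_iff scaleR_conv_of_real[where 'a = complex])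

lemma singular_value_iff:
  fixes M :: "complex ^ 'n ^ 'm"
  shows "s \<in> singular_values M \<longleftrightarrow> 0 \<le> s \<and> (\<exists>v. v \<noteq> 0 \<and> conj_transpose M *v (M *v v) = s\<^sup>2 *\<^sub>R v)"
  by (simp add: singular_values_def eigenvalue_def matrix_vector_mul_assoc of_real_scalar_mult
      flip: of_real_power)

lemma norm_at_singular_vector:
  fixes M :: "complex ^ 'n ^ 'm"
  assumes "0 \<le> s" "conj_transpose M *v (M *v v) = s\<^sup>2 *\<^sub>R v"
  shows "norm (M *v v) = s * norm v"
proof (rule power2_eq_imp_eq)
  have "(norm (M *v v))\<^sup>2 = v \<bullet> (s\<^sup>2 *\<^sub>R v)"
    unfolding power2_norm_eq_inner inner_adjoint_matrix assms(2) ..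
  then show "(norm (M *v v))\<^sup>2 = (s * norm v)\<^sup>2"
    by (simp add: dot_square_norm power_mult_distrib)
qed (simp_all add: assms(1))

text \<open>
  The top eigenvalue of \<open>M\<^sup>* M\<close> is the maximum of \<open>(norm (M x))\<^sup>2\<close> over unit vectors.
\<close>
lemma top_singular_value:
  fixes M :: "complex ^ 'n ^ 'm"
  obtains s where "s \<in> singular_values M" "\<And>x. norm (M *v x) \<le> s * norm x"
proof -
  define f where "f v = conj_transpose M *v (M *v v)" for v
  have "linear f"
    unfolding f_def matrix_vector_mul_assoc
    by (rule bounded_linear.linear[OF matrix_vector_mul_bounded_linear])
  moreover have "f x \<bullet> y = x \<bullet> f y" for x y
    unfolding f_def by (metis inner_adjoint_matrix inner_commute)
  ultimately obtain v \<mu> where v: "norm v = 1" "f v = \<mu> *\<^sub>R v" and max: "\<And>x. x \<bullet> f x \<le> \<mu> * (x \<bullet> x)"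
    using self_adjoint_max_eigenvector by blast
  have f: "x \<bullet> f x = (norm (M *v x))\<^sup>2" for x
    unfolding f_def power2_norm_eq_inner inner_adjoint_matrix ..
  have "\<mu> = v \<bullet> f v" using v by (simp add: norm_eq_1)
  then have "\<mu> \<ge> 0" by (simp add: f)
  have "v \<noteq> 0" using v by auto
  then have "sqrt \<mu> \<in> singular_values M"
    unfolding singular_value_iff using v \<open>\<mu> \<ge> 0\<close> by (auto simp: f_def)
  moreover have "norm (M *v x) \<le> sqrt \<mu> * norm x" for x
  proof (rule power2_le_imp_le)
    show "(norm (M *v x))\<^sup>2 \<le> (sqrt \<mu> * norm x)\<^sup>2"
      using max[of x] f[of x] \<open>\<mu> \<ge> 0\<close> by (simp add: power_mult_distrib dot_square_norm)
  qed (use \<open>\<mu> \<ge> 0\<close> in auto)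
  ultimately show thesis by (rule that)
qed

lemma sigma_max_le_iff:
  fixes M :: "complex ^ 'n ^ 'm"
  shows "sigma_max M \<le> g \<longleftrightarrow> (\<forall>x. norm (M *v x) \<le> g * norm x)"
proof -
  obtain s where s: "s \<in> singular_values M" and bound: "\<And>x. norm (M *v x) \<le> s * norm x"
    using top_singular_value[of M] by blast
  have le: "r \<le> g" if r: "r \<in> singular_values M" and g: "\<And>x. norm (M *v x) \<le> g * norm x" for r g
  proof -
    obtain v where "v \<noteq> 0" "norm (M *v v) = r * norm v"
      using r norm_at_singular_vector unfolding singular_value_iff by blast
    then show ?thesis using g[of v] by simp
  qed
  have "sigma_max M = s"
    unfolding sigma_max_def using s le[OF _ bound] by (intro cSup_eq_maximum)
  moreover have "\<forall>x. norm (M *v x) \<le> g * norm x" if "s \<le> g"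
    using bound that by (meson mult_right_mono norm_ge_zero order_trans)
  ultimately show ?thesis using le[OF s] by blast
qed

lemma norm_axis_complex: "norm (axis i 1 :: complex ^ 'n) = 1"
  by (simp add: inner_axis' norm_eq_1)

lemma sigma_max_nonneg: "0 \<le> sigma_max (M :: complex ^ 'n ^ 'm)"
proof -
  have "norm (M *v axis undefined 1) \<le> sigma_max M * norm (axis undefined 1 :: complex ^ 'n)"
    using sigma_max_le_iff[of M "sigma_max M"] by blast
  then have "norm (M *v axis undefined 1) \<le> sigma_max M" by (simp add: norm_axis_complex)
  then show ?thesis by (rule order_trans[OF norm_ge_zero])
qed

section \<open>Resolvents on the exterior of the unit disc\<close>

text \<open>
  A uniform bound on the resolvent outside the open unit disc, written without inverses so that it can be
  perturbed and passed to limits; it holds for some \<open>c\<close> exactly for the stable matrices.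
\<close>
definition resolvent_bound :: "real \<Rightarrow> complex ^ 'n ^ 'n \<Rightarrow> bool" where
  "resolvent_bound c M \<longleftrightarrow> (\<forall>z x. 1 \<le> cmod z \<longrightarrow> norm x \<le> c * norm (z *s x - M *v x))"

lemma norm_scalar_mult: "norm (z *s x) = cmod z * norm (x :: complex ^ 'n)"
  by (simp add: norm_vec_def norm_mult L2_set_right_distrib)

text \<open>
  For a stable matrix the quotient of \<open>norm (z x - M x)\<close> by \<open>norm x\<close> is positive and attains its minimum when
  \<open>z\<close> ranges over a compact annulus; for \<open>z\<close> beyond the annulus it is at least 1.
\<close>
lemma schur_stable_iff_resolvent_bound:
  fixes M :: "real ^ 'n ^ 'n"
  shows "schur_stable M \<longleftrightarrow> (\<exists>c>0. resolvent_bound c (cmat M))"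
proof
  assume "\<exists>c>0. resolvent_bound c (cmat M)"
  then obtain c where c: "\<And>z x. 1 \<le> cmod z \<Longrightarrow> norm x \<le> c * norm (z *s x - cmat M *v x)"
    unfolding resolvent_bound_def by blast
  have "cmod z < 1" if "v \<noteq> 0" "cmat M *v v = z *s v" for z v
    using c[of z v] that by (cases "cmod z < 1") simp_all
  then show "schur_stable M" unfolding schur_stable_def eigenvalue_def by blast
next
  assume stable: "schur_stable M"
  let ?A = "cmat M"
  define r where "r = norm ?A + 1"
  let ?S = "{z::complex. 1 \<le> cmod z \<and> cmod z \<le> r} \<times> sphere (0 :: complex ^ 'n) 1"
  have "{z::complex. 1 \<le> cmod z \<and> cmod z \<le> r} = cball 0 r - ball 0 1" by auto
  then have "compact ?S" by (intro compact_Times) (simp_all add: compact_diff)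
  moreover have "(1, axis undefined 1) \<in> ?S" by (simp add: r_def norm_axis_complex)
  then have "?S \<noteq> {}" by blast
  moreover have "continuous_on ?S (\<lambda>p. norm (fst p *s snd p - ?A *v snd p))"
    unfolding vector_scalar_mult_def
    by (intro continuous_intros linear_continuous_on_compose[OF _ bounded_linear.linear[OF matrix_vector_mul_bounded_linear]])
  ultimately obtain p where p: "p \<in> ?S"
    and min: "\<And>q. q \<in> ?S \<Longrightarrow> norm (fst p *s snd p - ?A *v snd p) \<le> norm (fst q *s snd q - ?A *v snd q)"
    using continuous_attains_inf[of ?S "\<lambda>p. norm (fst p *s snd p - ?A *v snd p)"] by blast
  define b where "b = min 1 (norm (fst p *s snd p - ?A *v snd p))"
  have "fst p *s snd p \<noteq> ?A *v snd p"
  proof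
    assume "fst p *s snd p = ?A *v snd p"
    moreover have "snd p \<noteq> 0" using p by auto
    ultimately have "cmod (fst p) < 1"
      using stable unfolding schur_stable_def eigenvalue_def by metis
    then show False using p by auto
  qed
  then have "b > 0" by (simp add: b_def)
  have "b * norm x \<le> norm (z *s x - ?A *v x)" if z: "1 \<le> cmod z" for z x
  proof (cases "x = 0")
    case False
    show ?thesis
    proof (cases "cmod z \<le> r")
      case True
      let ?u = "(1 / norm x) *\<^sub>R x"
      have "b \<le> norm (z *s ?u - ?A *v ?u)"
        using min[of "(z, ?u)"] z True False by (simp add: b_def)
      also have "z *s ?u - ?A *v ?u = (1 / norm x) *\<^sub>R (z *s x - ?A *v x)"
        unfolding linear_cmul[OF bounded_linear.linear[OF matrix_vector_mul_bounded_linear]]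
        by (simp add: vec_eq_iff scaleR_right_diff_distrib)
      finally have "b \<le> (1 / norm x) * norm (z *s x - ?A *v x)" by (simp only: norm_scaleR) simp
      then show ?thesis using False by (simp add: field_simps)
    next
      case False
      have "b * norm x \<le> 1 * norm x" by (intro mult_right_mono) (simp_all add: b_def)
      also have "\<dots> \<le> (cmod z - norm ?A) * norm x"
        using False by (intro mult_right_mono) (simp_all add: r_def)
      also have "\<dots> \<le> norm (z *s x - ?A *v x)"
        using norm_triangle_ineq2[of "z *s x" "?A *v x"] norm_matrix_vector_mult_le[of ?A x]
        by (simp add: norm_scalar_mult algebra_simps)
      finally show ?thesis .
    qed
  qed simp
  then have "resolvent_bound (1 / b) ?A"
    using \<open>b > 0\<close> by (simp add: resolvent_bound_def field_simps)
  then show "\<exists>c>0. resolvent_bound c ?A" using \<open>b > 0\<close> by (intro exI[of _ "1 / b"]) simp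
qed

lemma resolvent_bound_perturb:
  assumes M: "resolvent_bound c M" and small: "c * norm (N - M) \<le> 1 / 2" and "c > 0"
  shows "resolvent_bound (2 * c) N"
  unfolding resolvent_bound_def
proof (intro allI impI)
  fix z x assume z: "1 \<le> cmod z"
  have "norm x \<le> c * norm (z *s x - M *v x)" using M z by (simp add: resolvent_bound_def)
  also have "norm (z *s x - M *v x) \<le> norm (z *s x - N *v x) + norm ((N - M) *v x)"
    using norm_triangle_ineq[of "z *s x - N *v x" "(N - M) *v x"]
    by (simp add: matrix_vector_mult_diff_rdistrib)
  also have "norm ((N - M) *v x) \<le> norm (N - M) * norm x" by (rule norm_matrix_vector_mult_le)
  finally have "norm x \<le> c * norm (z *s x - N *v x) + (c * norm (N - M)) * norm x"
    using \<open>c > 0\<close> by (simp add: algebra_simps)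
  also have "(c * norm (N - M)) * norm x \<le> 1 / 2 * norm x"
    using small by (intro mult_right_mono) auto
  finally show "norm x \<le> 2 * c * norm (z *s x - N *v x)" by simp
qed

lemma resolvent_solve:
  fixes M :: "complex ^ 'n ^ 'n"
  assumes "resolvent_bound c M" "1 \<le> cmod z"
  shows "z *s x - M *v x = y \<longleftrightarrow> x = matrix_inv (mat z - M) *v y"
proof -
  have "mat z *v x = z *s x" for x :: "complex ^ 'n"
    by (simp add: vec_eq_iff matrix_vector_mult_def mat_def if_distrib if_distribR cong: if_cong)
  then have eq: "(mat z - M) *v x = z *s x - M *v x" for x
    by (simp add: matrix_vector_mult_diff_rdistrib)
  have "x = 0" if "(mat z - M) *v x = 0" for x
  proof -
    have "norm x \<le> c * norm (z *s x - M *v x)" using assms by (simp add: resolvent_bound_def)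
    then show ?thesis using that by (simp add: eq)
  qed
  then obtain N where N: "N ** (mat z - M) = mat 1"
    using matrix_left_invertible_ker by blast
  then have "invertible (mat z - M)"
    unfolding invertible_def using matrix_left_right_inverse by blast
  then have inv: "(mat z - M) ** matrix_inv (mat z - M) = mat 1" "matrix_inv (mat z - M) ** (mat z - M) = mat 1"
    unfolding invertible_def matrix_inv_def by (metis (mono_tags, lifting) someI_ex)+
  show ?thesis
    unfolding eq[symmetric] using inv
    by (metis matrix_vector_mul_assoc matrix_vector_mul_lid)
qed

section \<open>The peak gain of a transfer matrix and its continuity\<close>

text \<open>
  The H-infinity norm of the transfer matrix \<open>H (z - A)\<^sup>-\<^sup>1 W\<close>; the cost of a gain \<open>K\<close> is an instance.
\<close>
definition peak_gain ::
  "complex ^ 'x ^ 'x \<Rightarrow> complex ^ 'x ^ 'z \<Rightarrow> complex ^ 'w ^ 'x \<Rightarrow> real" where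
  "peak_gain A H W = (SUP \<omega>\<in>{0..2 * pi}. sigma_max (H ** matrix_inv (mat (cis \<omega>) - A) ** W))"

lemma unit_circle_cis:
  assumes "cmod z = 1"
  obtains \<omega> where "\<omega> \<in> {0..2 * pi}" "z = cis \<omega>"
proof
  show "Arg2pi z \<in> {0..2 * pi}" using Arg2pi_ge_0[of z] Arg2pi_lt_2pi[of z] by simp
  show "z = cis (Arg2pi z)" using assms by (simp add: cis_conv_exp complex_norm_eq_1_exp)
qed

lemma sigma_max_transfer_le_iff:
  assumes "resolvent_bound c A" "cmod z = 1"
  shows "sigma_max (H ** matrix_inv (mat z - A) ** W) \<le> g \<longleftrightarrow>
    (\<forall>x v. z *s x - A *v x = W *v v \<longrightarrow> norm (H *v x) \<le> g * norm v)"
  unfolding sigma_max_le_iff using resolvent_solve[OF assms(1), of z] assms(2)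
  by (simp flip: matrix_vector_mul_assoc)

lemma resolvent_norm_le:
  assumes "resolvent_bound c A" "1 \<le> cmod z" "z *s x - A *v x = W *v v" "c > 0"
  shows "norm x \<le> c * norm W * norm v"
proof -
  have "norm x \<le> c * norm (W *v v)" using assms unfolding resolvent_bound_def by metis
  also have "\<dots> \<le> c * (norm W * norm v)"
    using norm_matrix_vector_mult_le \<open>c > 0\<close> by (intro mult_left_mono) auto
  finally show ?thesis by simp
qed

lemma bdd_above_transfer:
  assumes A: "resolvent_bound c A" and "c > 0"
  shows "bdd_above ((\<lambda>\<omega>. sigma_max (H ** matrix_inv (mat (cis \<omega>) - A) ** W)) ` {0..2 * pi})"
proof (rule bdd_aboveI2)
  fix \<omega> assume "\<omega> \<in> {0..2 * pi}"
  show "sigma_max (H ** matrix_inv (mat (cis \<omega>) - A) ** W) \<le> norm H * (c * norm W)"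
    unfolding sigma_max_transfer_le_iff[OF A norm_cis]
  proof (intro allI impI)
    fix x v assume "cis \<omega> *s x - A *v x = W *v v"
    then have "norm x \<le> c * norm W * norm v"
      by (intro resolvent_norm_le[OF A _ _ \<open>c > 0\<close>, of "cis \<omega>"]) simp_all
    then have "norm H * norm x \<le> norm H * (c * norm W * norm v)"
      by (intro mult_left_mono) simp_all
    then show "norm (H *v x) \<le> norm H * (c * norm W) * norm v"
      using norm_matrix_vector_mult_le[of H x] by simp
  qed
qed

text \<open>
  Describing the peak gain through solutions of \<open>z x - A x = W v\<close> eliminates singular values, inverses and
  the supremum, and turns comparisons of gains into estimates of solutions.
\<close>
lemma peak_gain_le_iff:
  assumes A: "resolvent_bound c A" and "c > 0"
  shows "peak_gain A H W \<le> g \<longleftrightarrow>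
    (\<forall>z x v. cmod z = 1 \<longrightarrow> z *s x - A *v x = W *v v \<longrightarrow> norm (H *v x) \<le> g * norm v)"
proof -
  have "peak_gain A H W \<le> g \<longleftrightarrow>
      (\<forall>\<omega>\<in>{0..2 * pi}. sigma_max (H ** matrix_inv (mat (cis \<omega>) - A) ** W) \<le> g)"
    unfolding peak_gain_def by (rule cSUP_le_iff) (simp_all add: bdd_above_transfer[OF assms])
  also have "\<dots> \<longleftrightarrow> (\<forall>z. cmod z = 1 \<longrightarrow> sigma_max (H ** matrix_inv (mat z - A) ** W) \<le> g)"
    by (metis norm_cis unit_circle_cis)
  finally show ?thesis using sigma_max_transfer_le_iff[OF A] by metis
qed

lemma peak_gain_nonneg:
  assumes "resolvent_bound c A" "c > 0"
  shows "0 \<le> peak_gain A H W"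
  unfolding peak_gain_def
  by (rule cSUP_upper2[OF bdd_above_transfer[OF assms], of 0]) (simp_all add: sigma_max_nonneg)

text \<open>
  Solutions \<open>x\<close> and \<open>x'\<close> for \<open>A\<close> and \<open>A'\<close> with the same input differ by a solution of
  \<open>z y - A y = (A' - A) x'\<close>, which the resolvent bound controls.
\<close>
lemma peak_gain_perturb:
  fixes A A' :: "complex ^ 'x ^ 'x" and H H' :: "complex ^ 'x ^ 'z" and W :: "complex ^ 'w ^ 'x"
  assumes A: "resolvent_bound c A" and A': "resolvent_bound c A'" and "c > 0"
  shows "peak_gain A' H' W \<le>
    peak_gain A H W + (norm H * c * norm (A' - A) + norm (H' - H)) * (c * norm W)"
  unfolding peak_gain_le_iff[OF A' \<open>c > 0\<close>]
proof (intro allI impI)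
  fix z x' v
  assume z: "cmod z = 1" and x': "z *s x' - A' *v x' = W *v v"
  define x where "x = matrix_inv (mat z - A) *v (W *v v)"
  have x: "z *s x - A *v x = W *v v"
    using resolvent_solve[OF A, of z x] z by (simp add: x_def)
  have Hx: "norm (H *v x) \<le> peak_gain A H W * norm v"
    using peak_gain_le_iff[OF A \<open>c > 0\<close>, of H W "peak_gain A H W"] x z by blast
  have nx': "norm x' \<le> c * norm W * norm v"
    using resolvent_norm_le[OF A' _ x' \<open>c > 0\<close>] z by simp
  have "z *s (x' - x) - A *v (x' - x) = (z *s x' - A *v x') - (z *s x - A *v x)"
    by (simp add: matrix_vector_mult_diff_distrib vec.scale_right_diff_distrib)
  also have "\<dots> = (A' - A) *v x'"
    unfolding x x'[symmetric] by (simp add: matrix_vector_mult_diff_rdistrib)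
  finally have "norm (x' - x) \<le> c * norm (A' - A) * norm x'"
    by (intro resolvent_norm_le[OF A _ _ \<open>c > 0\<close>, of z]) (simp_all add: z)
  then have d: "norm H * norm (x' - x) \<le> norm H * (c * norm (A' - A) * norm x')"
    by (intro mult_left_mono) auto
  have "H' *v x' = (H' - H) *v x' + H *v (x' - x) + H *v x"
    by (simp add: matrix_vector_mult_diff_rdistrib matrix_vector_mult_diff_distrib)
  then have "norm (H' *v x') \<le> norm ((H' - H) *v x') + norm (H *v (x' - x)) + norm (H *v x)"
    by (metis norm_triangle_ineq norm_triangle_le add_mono order_refl)
  also have "\<dots> \<le> norm (H' - H) * norm x' + norm H * (c * norm (A' - A) * norm x') + norm (H *v x)"
    using d norm_matrix_vector_mult_le[of "H' - H" x'] norm_matrix_vector_mult_le[of H "x' - x"]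
    by linarith
  also have "norm (H' - H) * norm x' + norm H * (c * norm (A' - A) * norm x')
      = (norm H * c * norm (A' - A) + norm (H' - H)) * norm x'"
    by (simp add: algebra_simps)
  also have "\<dots> \<le> (norm H * c * norm (A' - A) + norm (H' - H)) * (c * norm W * norm v)"
    using nx' \<open>c > 0\<close> by (intro mult_left_mono) auto
  finally show "norm (H' *v x') \<le>
      (peak_gain A H W + (norm H * c * norm (A' - A) + norm (H' - H)) * (c * norm W)) * norm v"
    using Hx by (simp add: algebra_simps)
qed

lemma peak_gain_tendsto:
  assumes A: "(Af \<longlongrightarrow> A) F" and H: "(Hf \<longlongrightarrow> H) F" and bound: "resolvent_bound c A" and "c > 0"
  shows "((\<lambda>i. peak_gain (Af i) (Hf i) W) \<longlongrightarrow> peak_gain A H W) F"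
proof (rule tendsto_sandwich)
  let ?up = "\<lambda>i. peak_gain A H W +
    (norm H * (2 * c) * norm (Af i - A) + norm (Hf i - H)) * (2 * c * norm W)"
  let ?lo = "\<lambda>i. peak_gain A H W -
    (norm (Hf i) * (2 * c) * norm (A - Af i) + norm (H - Hf i)) * (2 * c * norm W)"
  have "((\<lambda>i. c * norm (Af i - A)) \<longlongrightarrow> c * norm (A - A)) F" by (intro tendsto_intros A)
  then have "\<forall>\<^sub>F i in F. c * norm (Af i - A) < 1 / 2" by (rule order_tendstoD) simp
  then have near: "\<forall>\<^sub>F i in F. resolvent_bound (2 * c) (Af i)"
    by eventually_elim (rule resolvent_bound_perturb[OF bound _ \<open>c > 0\<close>], simp)
  have "resolvent_bound (2 * c) A"
    using resolvent_bound_perturb[OF bound _ \<open>c > 0\<close>, of A] by simp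
  then show "\<forall>\<^sub>F i in F. peak_gain (Af i) (Hf i) W \<le> ?up i" "\<forall>\<^sub>F i in F. ?lo i \<le> peak_gain (Af i) (Hf i) W"
    using near peak_gain_perturb[of "2 * c"] \<open>c > 0\<close>
    by (auto elim!: eventually_mono simp: diff_le_eq)
  have "(?up \<longlongrightarrow> peak_gain A H W + (norm H * (2 * c) * norm (A - A) + norm (H - H)) * (2 * c * norm W)) F"
    by (intro tendsto_intros A H)
  then show "(?up \<longlongrightarrow> peak_gain A H W) F" by simp
  have "(?lo \<longlongrightarrow> peak_gain A H W - (norm H * (2 * c) * norm (A - A) + norm (H - H)) * (2 * c * norm W)) F"
    by (intro tendsto_intros A H)
  then show "(?lo \<longlongrightarrow> peak_gain A H W) F" by simp
qed

lemma resolvent_bound_limit: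
  assumes A: "(Af \<longlongrightarrow> A) F" and "F \<noteq> bot" and ev: "\<forall>\<^sub>F i in F. resolvent_bound c (Af i)"
  shows "resolvent_bound c A"
  unfolding resolvent_bound_def
proof (intro allI impI)
  fix z x assume z: "1 \<le> cmod z"
  have "((\<lambda>i. norm ((Af i - A) *v x)) \<longlongrightarrow> 0) F"
  proof (rule tendsto_sandwich[OF _ _ tendsto_const])
    have "((\<lambda>i. norm (Af i - A) * norm x) \<longlongrightarrow> norm (A - A) * norm x) F" by (intro tendsto_intros A)
    then show "((\<lambda>i. norm (Af i - A) * norm x) \<longlongrightarrow> 0) F" by simp
  qed (simp_all add: norm_matrix_vector_mult_le)
  then have "((\<lambda>i. (Af i - A) *v x) \<longlongrightarrow> 0) F" by (rule tendsto_norm_zero_cancel)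
  then have "((\<lambda>i. c * norm (z *s x - A *v x - (Af i - A) *v x)) \<longlongrightarrow> c * norm (z *s x - A *v x - 0)) F"
    by (intro tendsto_intros)
  moreover have "\<forall>\<^sub>F i in F. norm x \<le> c * norm (z *s x - A *v x - (Af i - A) *v x)"
    using ev by (rule eventually_mono) (simp add: z resolvent_bound_def matrix_vector_mult_diff_rdistrib)
  ultimately show "norm x \<le> c * norm (z *s x - A *v x)"
    using tendsto_lowerbound \<open>F \<noteq> bot\<close> by fastforce
qed

section \<open>Maximum modulus bounds for the transfer matrix\<close>

lemma holomorphic_on_det:
  fixes M :: "complex \<Rightarrow> complex ^ 'n ^ 'n"
  assumes "\<And>i j. (\<lambda>z. M z $ i $ j) holomorphic_on S"
  shows "(\<lambda>z. det (M z)) holomorphic_on S"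
  unfolding det_def by (intro holomorphic_intros assms)

lemma cmod_sum_cnj_mult_le:
  fixes u w :: "complex ^ 'n"
  shows "cmod (\<Sum>i\<in>UNIV. cnj (u $ i) * w $ i) \<le> norm u * norm w"
proof -
  have "cmod (\<Sum>i\<in>UNIV. cnj (u $ i) * w $ i) \<le> (\<Sum>i\<in>UNIV. \<bar>cmod (u $ i)\<bar> * \<bar>cmod (w $ i)\<bar>)"
    by (rule order_trans[OF norm_sum]) (simp add: norm_mult)
  also have "\<dots> \<le> norm u * norm w" unfolding norm_vec_def by (rule L2_set_mult_ineq)
  finally show ?thesis .
qed

lemma sum_cnj_mult_self: "(\<Sum>i\<in>UNIV. cnj (u $ i) * u $ i) = complex_of_real ((norm (u :: complex ^ 'n))\<^sup>2)"
  by (simp add: norm_vec_def L2_set_def sum_nonneg complex_norm_square mult.commute del: of_real_power)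

text \<open>
  With \<open>\<zeta> = 1 / z\<close>, the equation \<open>x - \<zeta> A x = W v\<close> is, up to a unimodular factor on \<open>x\<close>, the one that defines
  the peak gain when \<open>\<zeta>\<close> is on the unit circle. Its solution is analytic on the disc by
  Cramer's rule, so the maximum modulus principle applies to its image under \<open>H\<close>, paired with the fixed vector
  \<open>u\<close> that it attains at \<open>\<zeta>0\<close>.
\<close>
lemma gain_bound_in_disc:
  fixes A :: "complex ^ 'x ^ 'x" and H :: "complex ^ 'x ^ 'z" and W :: "complex ^ 'w ^ 'x"
  assumes A: "resolvent_bound c A" and "c > 0" and g: "peak_gain A H W \<le> g"
    and \<zeta>0: "cmod \<zeta>0 \<le> 1" and x0: "x0 - \<zeta>0 *s (A *v x0) = W *v v"
  shows "norm (H *v x0) \<le> g * norm v"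
proof -
  define M where "M \<zeta> = mat 1 - map_matrix ((*) \<zeta>) A" for \<zeta>
  have "map_matrix ((*) \<zeta>) A *v x = \<zeta> *s (A *v x)" for \<zeta> x
    by (simp add: vec_eq_iff matrix_vector_mult_def sum_distrib_left mult.assoc)
  then have M: "M \<zeta> *v x = x - \<zeta> *s (A *v x)" for \<zeta> x
    by (simp add: M_def matrix_vector_mult_diff_rdistrib)
  have det: "det (M \<zeta>) \<noteq> 0" if "cmod \<zeta> \<le> 1" for \<zeta>
  proof -
    have "x = 0" if "M \<zeta> *v x = 0" for x
    proof (cases "\<zeta> = 0")
      case False
      then have "(1 / \<zeta>) *s x - A *v x = (1 / \<zeta>) *s (M \<zeta> *v x)"
        by (simp add: M vec_eq_iff field_simps)
      then have "(1 / \<zeta>) *s x - A *v x = 0" using that by simp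
      moreover have "1 \<le> cmod (1 / \<zeta>)"
        using False \<open>cmod \<zeta> \<le> 1\<close> by (simp add: norm_divide field_simps)
      ultimately have "norm x \<le> c * norm (0 :: complex ^ 'x)"
        using A unfolding resolvent_bound_def by metis
      then show ?thesis by simp
    qed (use that M in simp)
    then have "invertible (M \<zeta>)"
      by (metis invertible_def matrix_left_invertible_ker matrix_left_right_inverse)
    then show ?thesis by (simp add: invertible_det_nz)
  qed
  define sol where
    "sol \<zeta> = (\<chi> k. det (\<chi> i j. if j = k then (W *v v) $ i else M \<zeta> $ i $ j) / det (M \<zeta>))" for \<zeta>
  have sol: "M \<zeta> *v x = W *v v \<longleftrightarrow> x = sol \<zeta>" if "cmod \<zeta> \<le> 1" for \<zeta> x
    unfolding sol_def using cramer[OF det[OF that]] by blast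
  define u where "u = H *v x0"
  define f where "f \<zeta> = (\<Sum>i\<in>UNIV. cnj (u $ i) * (H *v sol \<zeta>) $ i)" for \<zeta>
  have holM: "(\<lambda>\<zeta>. M \<zeta> $ i $ j) holomorphic_on S" for i j S
    unfolding M_def by (simp, intro holomorphic_intros)
  have holsol: "(\<lambda>\<zeta>. sol \<zeta> $ k) holomorphic_on cball 0 1" for k
    unfolding sol_def vec_lambda_beta
  proof (intro holomorphic_on_divide holomorphic_on_det)
    show "(\<lambda>\<zeta>. (\<chi> i j. if j = k then (W *v v) $ i else M \<zeta> $ i $ j) $ i $ j) holomorphic_on cball 0 1" for i j
      by (cases "j = k") (simp_all add: holM)
  qed (use det holM in auto)
  have hol: "f holomorphic_on cball 0 1"
    unfolding f_def matrix_vector_mult_def vec_lambda_beta by (intro holomorphic_intros holsol)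
  have circle: "cmod (f \<zeta>) \<le> norm u * (g * norm v)" if "cmod \<zeta> = 1" for \<zeta>
  proof -
    have "\<zeta> \<noteq> 0" using that by auto
    have "sol \<zeta> - \<zeta> *s (A *v sol \<zeta>) = W *v v" using sol[of \<zeta> "sol \<zeta>"] that by (simp add: M)
    then have "(1 / \<zeta>) *s (\<zeta> *s sol \<zeta>) - A *v (\<zeta> *s sol \<zeta>) = W *v v"
      using \<open>\<zeta> \<noteq> 0\<close> by (simp add: vec.scale)
    moreover have "cmod (1 / \<zeta>) = 1" using that by (simp add: norm_divide)
    ultimately have "norm (H *v (\<zeta> *s sol \<zeta>)) \<le> g * norm v"
      using g unfolding peak_gain_le_iff[OF A \<open>c > 0\<close>] by blast
    moreover have "norm (H *v (\<zeta> *s sol \<zeta>)) = norm (H *v sol \<zeta>)"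
      using that by (simp add: vec.scale norm_scalar_mult)
    ultimately have "norm u * norm (H *v sol \<zeta>) \<le> norm u * (g * norm v)"
      by (intro mult_left_mono) auto
    then show ?thesis
      unfolding f_def using cmod_sum_cnj_mult_le[of u "H *v sol \<zeta>"] by linarith
  qed
  have "cmod (f \<zeta>0) \<le> norm u * (g * norm v)"
  proof (rule maximum_modulus_frontier[of f "cball 0 1"])
    show "f holomorphic_on interior (cball 0 1)"
      using hol by (rule holomorphic_on_subset) (rule interior_subset)
    show "continuous_on (closure (cball 0 1)) f"
      using hol by (simp add: holomorphic_on_imp_continuous_on)
  qed (use circle \<zeta>0 in \<open>auto simp: frontier_cball\<close>)
  moreover have "x0 = sol \<zeta>0" using sol[OF \<zeta>0] x0 by (simp add: M)
  then have "f \<zeta>0 = complex_of_real ((norm u)\<^sup>2)"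
    by (simp add: f_def u_def sum_cnj_mult_self flip: of_real_power)
  ultimately have "norm u * norm u \<le> norm u * (g * norm v)"
    by (simp add: norm_power power2_eq_square norm_mult)
  then show ?thesis
  proof (cases "norm u = 0")
    case True
    have "0 \<le> g" using peak_gain_nonneg[OF A \<open>c > 0\<close>, of H W] g by linarith
    then show ?thesis using True unfolding u_def by simp
  qed (simp add: u_def)
qed

text \<open>
  The resulting constant does not depend on \<open>c\<close>, so it is uniform over a sublevel set of the cost.
\<close>
lemma resolvent_bound_from_peak_gain:
  fixes A :: "complex ^ 'x ^ 'x" and H :: "complex ^ 'x ^ 'z" and W :: "complex ^ 'w ^ 'x"
  assumes A: "resolvent_bound c A" and "c > 0" and g: "peak_gain A H W \<le> g"
    and W': "W ** W' = mat 1" and H: "\<And>x. norm x \<le> h * norm (H *v x)" and "h \<ge> 0"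
  shows "resolvent_bound (h * g * norm W') A"
  unfolding resolvent_bound_def
proof (intro allI impI)
  fix z x assume z: "1 \<le> cmod z"
  then have "z \<noteq> 0" by auto
  define y where "y = z *s x - A *v x"
  have "0 \<le> g" using peak_gain_nonneg[OF A \<open>c > 0\<close>, of H W] g by linarith
  have "W *v (W' *v y) = y" by (simp add: matrix_vector_mul_assoc W')
  then have "z *s x - (1 / z) *s (A *v (z *s x)) = W *v (W' *v y)"
    using \<open>z \<noteq> 0\<close> by (simp add: y_def vec.scale)
  then have "norm (H *v (z *s x)) \<le> g * norm (W' *v y)"
    using z by (intro gain_bound_in_disc[OF A \<open>c > 0\<close> g, of "1 / z"]) (simp_all add: norm_divide divide_le_eq)
  then have "cmod z * norm (H *v x) \<le> g * norm (W' *v y)"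
    by (simp add: vec.scale norm_scalar_mult)
  moreover have "1 * norm (H *v x) \<le> cmod z * norm (H *v x)" using z by (intro mult_right_mono) auto
  moreover have "g * norm (W' *v y) \<le> g * (norm W' * norm y)"
    using \<open>0 \<le> g\<close> norm_matrix_vector_mult_le by (intro mult_left_mono)
  ultimately have "norm (H *v x) \<le> g * (norm W' * norm y)" by linarith
  then have "h * norm (H *v x) \<le> h * (g * (norm W' * norm y))" using \<open>h \<ge> 0\<close> by (rule mult_left_mono)
  then show "norm x \<le> h * g * norm W' * norm (z *s x - A *v x)"
    using H[of x] by (simp add: y_def mult.assoc)
qed

section \<open>Sublevel sets of the H-infinity cost\<close>

lemma cmat_mult: "cmat (M ** N) = cmat M ** cmat N"
  by (simp add: vec_eq_iff matrix_matrix_mult_def)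

lemma cmat_one: "cmat (mat 1) = mat 1"
  by (simp add: vec_eq_iff mat_def)

lemma norm_subvector_le:
  fixes y :: "'a::real_normed_vector ^ 'm"
  assumes "inj f" and "\<And>i. x $ i = y $ f i"
  shows "norm x \<le> norm y"
proof -
  have "(\<Sum>i\<in>UNIV. (norm (x $ i))\<^sup>2) = (\<Sum>i\<in>range f. (norm (y $ i))\<^sup>2)"
    using assms by (simp add: sum.reindex)
  also have "\<dots> \<le> (\<Sum>i\<in>UNIV. (norm (y $ i))\<^sup>2)" by (rule sum_mono2) auto
  finally show ?thesis by (simp add: norm_vec_def L2_set_def)
qed

lemma norm_vstack_mult_ge:
  shows "norm (cmat M *v x) \<le> norm (cmat (vstack M N) *v x)"
    and "norm (cmat N *v x) \<le> norm (cmat (vstack M N) *v x)"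
  by (rule norm_subvector_le[of Inl]; simp add: vstack_def matrix_vector_mult_def)
     (rule norm_subvector_le[of Inr]; simp add: vstack_def matrix_vector_mult_def)

lemma norm_le_of_left_inverse:
  fixes M :: "real ^ 'n ^ 'm"
  assumes "M' ** M = mat 1"
  shows "norm x \<le> norm (cmat M') * norm (cmat M *v x)"
proof -
  have "x = cmat M' *v (cmat M *v x)"
    by (simp add: matrix_vector_mul_assoc assms cmat_one flip: cmat_mult)
  then show ?thesis by (metis norm_matrix_vector_mult_le)
qed

lemma full_row_rank_right_inverse:
  assumes "full_row_rank M"
  obtains M' where "M ** M' = mat 1"
  using assms unfolding full_row_rank_def full_rank_surjective matrix_right_invertible_surjective[symmetric]
  by blast

text \<open>
  The data of the control problem. The rank conditions allow every state to be driven and every output direction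
  to be reached; definiteness makes the state and the control visible in the cost.
\<close>
locale hinf_problem =
  fixes A :: "real ^ 'x ^ 'x" and B :: "real ^ 'u ^ 'x" and Bw :: "real ^ 'w ^ 'x"
    and C :: "real ^ 'x ^ 'y" and Q :: "real ^ 'x ^ 'x" and R :: "real ^ 'u ^ 'u"
  assumes Bw: "full_row_rank Bw" and C: "full_row_rank C" and Q: "pos_def Q" and R: "pos_def R"
begin

abbreviation "stab \<equiv> stabilizing_gains A B C"
abbreviation "cost \<equiv> hinf_cost A B Bw C Q R"
definition "state_matrix K = cmat (A + B ** K ** C)"
definition "output_matrix K = cmat (vstack (psd_sqrt Q) (psd_sqrt R ** K ** C))"

lemma cost_eq_peak_gain: "cost K = peak_gain (state_matrix K) (output_matrix K) (cmat Bw)"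
  unfolding hinf_cost_def T_zw_def peak_gain_def state_matrix_def output_matrix_def ..

lemma stab_iff_resolvent_bound: "K \<in> stab \<longleftrightarrow> (\<exists>c>0. resolvent_bound c (state_matrix K))"
  by (simp add: stabilizing_gains_def schur_stable_iff_resolvent_bound state_matrix_def)

lemma tendsto_state_matrix:
  assumes "(f \<longlongrightarrow> K) F"
  shows "((\<lambda>i. state_matrix (f i)) \<longlongrightarrow> state_matrix K) F"
  unfolding state_matrix_def map_matrix_def matrix_matrix_mult_def
  by (intro tendsto_vec_lambda) (simp, intro tendsto_intros assms)

lemma tendsto_output_matrix:
  assumes "(f \<longlongrightarrow> K) F"
  shows "((\<lambda>i. output_matrix (f i)) \<longlongrightarrow> output_matrix K) F"
  unfolding output_matrix_def map_matrix_def
proof (intro tendsto_vec_lambda)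
  fix i j
  show "((\<lambda>n. complex_of_real (vstack (psd_sqrt Q) (psd_sqrt R ** f n ** C) $ i $ j)) \<longlongrightarrow>
      complex_of_real (vstack (psd_sqrt Q) (psd_sqrt R ** K ** C) $ i $ j)) F"
    by (cases i) (simp_all add: vstack_def matrix_matrix_mult_def, intro tendsto_intros assms)
qed

lemma cost_nonneg: "K \<in> stab \<Longrightarrow> 0 \<le> cost K"
  unfolding stab_iff_resolvent_bound cost_eq_peak_gain using peak_gain_nonneg by blast

lemma open_stab: "open stab"
  unfolding open_subopen[of stab]
proof
  fix K assume "K \<in> stab"
  then obtain c where "c > 0" and c: "resolvent_bound c (state_matrix K)"
    unfolding stab_iff_resolvent_bound by blast
  have "((\<lambda>K'. c * norm (state_matrix K' - state_matrix K)) \<longlongrightarrow>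
      c * norm (state_matrix K - state_matrix K)) (nhds K)"
    by (intro tendsto_intros tendsto_state_matrix filterlim_ident)
  then have "\<forall>\<^sub>F K' in nhds K. c * norm (state_matrix K' - state_matrix K) < 1 / 2"
    by (rule order_tendstoD) simp
  then have "\<forall>\<^sub>F K' in nhds K. K' \<in> stab"
  proof (rule eventually_mono)
    fix K' assume "c * norm (state_matrix K' - state_matrix K) < 1 / 2"
    then have "resolvent_bound (2 * c) (state_matrix K')"
      by (intro resolvent_bound_perturb[OF c _ \<open>c > 0\<close>]) simp
    then show "K' \<in> stab" unfolding stab_iff_resolvent_bound using \<open>c > 0\<close>
      by (intro exI[of _ "2 * c"]) simp
  qed
  then show "\<exists>T. open T \<and> K \<in> T \<and> T \<subseteq> stab" unfolding eventually_nhds by blast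
qed

lemma cost_tendsto:
  assumes "K \<in> stab" "(f \<longlongrightarrow> K) F"
  shows "((\<lambda>i. cost (f i)) \<longlongrightarrow> cost K) F"
proof -
  obtain c where "c > 0" "resolvent_bound c (state_matrix K)"
    using assms(1) unfolding stab_iff_resolvent_bound by blast
  then show ?thesis unfolding cost_eq_peak_gain
    by (intro peak_gain_tendsto tendsto_state_matrix tendsto_output_matrix assms(2))
qed

text \<open>
  Along a convergent sequence in the sublevel set the bound on the cost yields one resolvent bound
  for all members, which the limit inherits. So the limit is stabilizing, and continuity bounds its cost.
\<close>
lemma closed_sublevel: "closed {K \<in> stab. cost K \<le> g}"
  unfolding closed_sequential_limits
proof (intro allI impI, elim conjE)
  fix f K assume f: "\<forall>n. f n \<in> {K \<in> stab. cost K \<le> g}" and lim: "f \<longlonglongrightarrow> K"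
  obtain Bw' where "Bw ** Bw' = mat 1" using full_row_rank_right_inverse[OF Bw] .
  then have W: "cmat Bw ** cmat Bw' = mat 1" by (simp add: cmat_one flip: cmat_mult)
  obtain S where S: "S ** psd_sqrt Q = mat 1" using psd_sqrt_left_invertible[OF Q] .
  have H: "norm x \<le> norm (cmat S) * norm (output_matrix K *v x)" for K x
  proof -
    have "norm (cmat S) * norm (cmat (psd_sqrt Q) *v x) \<le> norm (cmat S) * norm (output_matrix K *v x)"
      unfolding output_matrix_def by (intro mult_left_mono norm_vstack_mult_ge) simp
    then show ?thesis using norm_le_of_left_inverse[OF S, of x] by linarith
  qed
  have "resolvent_bound (norm (cmat S) * g * norm (cmat Bw')) (state_matrix (f n))" for n
  proof -
    obtain c where "c > 0" "resolvent_bound c (state_matrix (f n))"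
      using f unfolding stab_iff_resolvent_bound by blast
    then show ?thesis
      using f by (intro resolvent_bound_from_peak_gain[OF _ _ _ W H]) (auto simp: cost_eq_peak_gain)
  qed
  then have b: "resolvent_bound (norm (cmat S) * g * norm (cmat Bw')) (state_matrix K)"
    by (intro resolvent_bound_limit[OF tendsto_state_matrix[OF lim]]) auto
  \<comment> \<open>The summand 1 makes the constant positive, which the characterization of stability asks for.\<close>
  have "resolvent_bound (norm (cmat S) * g * norm (cmat Bw') + 1) (state_matrix K)"
    unfolding resolvent_bound_def
  proof (intro allI impI)
    fix z x assume "1 \<le> cmod z"
    then show "norm x \<le> (norm (cmat S) * g * norm (cmat Bw') + 1) * norm (z *s x - state_matrix K *v x)"
      using b unfolding resolvent_bound_def distrib_right by (metis add_increasing2 mult_1 norm_ge_zero)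
  qed
  moreover have "0 \<le> g" using cost_nonneg[of "f 0"] spec[OF f, of 0] by simp
  then have "norm (cmat S) * g * norm (cmat Bw') + 1 > 0" by (simp add: add_nonneg_pos)
  ultimately have K: "K \<in> stab" unfolding stab_iff_resolvent_bound by blast
  have "cost K \<le> g"
    by (rule tendsto_upperbound[OF cost_tendsto[OF K lim]]) (use f in auto)
  then show "K \<in> {K \<in> stab. cost K \<le> g}" using K by simp
qed

text \<open>
  The value of the scaled transfer matrix at \<open>\<zeta> = 0\<close> contains the block \<open>R\<^sup>1\<^sup>/\<^sup>2 K C Bw\<close>, from which \<open>K\<close> is
  recovered with a left inverse of \<open>R\<^sup>1\<^sup>/\<^sup>2\<close> and right inverses of \<open>C\<close> and \<open>Bw\<close>.
\<close>
lemma gain_entry_bounded_by_cost: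
  obtains b where "\<And>K i j. K \<in> stab \<Longrightarrow> \<bar>K $ i $ j\<bar> \<le> cost K * b"
proof -
  obtain Bw' where Bw': "Bw ** Bw' = mat 1" using full_row_rank_right_inverse[OF Bw] .
  obtain C' where C': "C ** C' = mat 1" using full_row_rank_right_inverse[OF C] .
  obtain S where S: "S ** psd_sqrt R = mat 1" using psd_sqrt_left_invertible[OF R] .
  let ?V = "cmat (Bw' ** C')"
  have "\<bar>K $ i $ j\<bar> \<le> cost K * (norm ?V * norm (cmat S))" if K: "K \<in> stab" for K i j
  proof -
    define e :: "complex ^ 'y" where "e = axis j 1"
    obtain c where "c > 0" and c: "resolvent_bound c (state_matrix K)"
      using K unfolding stab_iff_resolvent_bound by blast
    have "norm (output_matrix K *v (cmat Bw *v (?V *v e))) \<le> cost K * norm (?V *v e)"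
      using gain_bound_in_disc[OF c \<open>c > 0\<close>, of "output_matrix K" "cmat Bw" "cost K" 0 "cmat Bw *v (?V *v e)" "?V *v e"]
      by (simp add: cost_eq_peak_gain)
    also have "\<dots> \<le> cost K * (norm ?V * norm e)"
      by (intro mult_left_mono norm_matrix_vector_mult_le cost_nonneg K)
    finally have out: "norm (output_matrix K *v (cmat Bw *v (?V *v e))) \<le> cost K * norm ?V"
      by (simp add: e_def norm_axis_complex)
    have "psd_sqrt R ** K ** C ** (Bw ** (Bw' ** C')) = psd_sqrt R ** K ** (C ** ((Bw ** Bw') ** C'))"
      by (simp only: matrix_mul_assoc)
    also have "\<dots> = psd_sqrt R ** K" by (simp add: Bw' C')
    finally have "cmat (psd_sqrt R ** K ** C) *v (cmat Bw *v (?V *v e)) = cmat (psd_sqrt R) *v (cmat K *v e)"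
      by (simp add: matrix_vector_mul_assoc flip: cmat_mult)
    then have "norm (cmat (psd_sqrt R) *v (cmat K *v e)) \<le> cost K * norm ?V"
      using out norm_vstack_mult_ge(2)[of "psd_sqrt R ** K ** C" "cmat Bw *v (?V *v e)" "psd_sqrt Q"]
      by (simp add: output_matrix_def)
    then have "norm (cmat S) * norm (cmat (psd_sqrt R) *v (cmat K *v e)) \<le> norm (cmat S) * (cost K * norm ?V)"
      by (intro mult_left_mono) auto
    then have "norm (cmat K *v e) \<le> norm (cmat S) * (cost K * norm ?V)"
      using norm_le_of_left_inverse[OF S, of "cmat K *v e"] by linarith
    moreover have "(cmat K *v e) $ i = complex_of_real (K $ i $ j)"
      by (simp add: e_def matrix_vector_mult_def axis_def if_distrib cong: if_cong)
    then have "\<bar>K $ i $ j\<bar> \<le> norm (cmat K *v e)"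
      using Finite_Cartesian_Product.norm_nth_le[of "cmat K *v e" i] by simp
    ultimately show ?thesis by (simp add: algebra_simps)
  qed
  then show thesis by (rule that)
qed

text \<open>
  Guarantees a nonempty frontier, without which the distance to it would be 0 by convention.
\<close>
lemma sublevel_not_UNIV: "{K \<in> stab. cost K \<le> g} \<noteq> UNIV"
proof
  assume UNIV: "{K \<in> stab. cost K \<le> g} = UNIV"
  obtain b where b: "\<And>K i j. K \<in> stab \<Longrightarrow> \<bar>K $ i $ j\<bar> \<le> cost K * b"
    using gain_entry_bounded_by_cost by blast
  define K :: "real ^ 'y ^ 'u" where "K = (\<chi> i j. \<bar>g\<bar> * \<bar>b\<bar> + 1)"
  have K: "K \<in> stab" "cost K \<le> g" using UNIV by auto
  have "\<bar>g\<bar> * \<bar>b\<bar> + 1 \<le> cost K * b" using b[OF K(1)] by (simp add: K_def)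
  also have "\<dots> \<le> cost K * \<bar>b\<bar>" using cost_nonneg[OF K(1)] by (intro mult_left_mono) auto
  also have "\<dots> \<le> \<bar>g\<bar> * \<bar>b\<bar>" using K(2) by (intro mult_right_mono) auto
  finally show False by simp
qed

text \<open>
  A point of the closed sublevel set with cost below \<open>g\<close> is interior, as the stabilizing gains form an open
  set on which the cost is continuous.
\<close>
lemma cost_at_frontier:
  assumes "K \<in> frontier {K \<in> stab. cost K \<le> g}"
  shows "K \<in> stab" "cost K = g"
proof -
  let ?S = "{K \<in> stab. cost K \<le> g}"
  have "K \<in> ?S" and notint: "K \<notin> interior ?S"
    using assms closed_sublevel[of g] by (auto simp: frontier_def)
  then show K: "K \<in> stab" by simp
  show "cost K = g"
  proof (rule ccontr)
    assume "cost K \<noteq> g"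
    then have "cost K < g" using \<open>K \<in> ?S\<close> by simp
    then have "\<forall>\<^sub>F K' in nhds K. cost K' < g"
      using order_tendstoD(2)[OF cost_tendsto[OF K filterlim_ident]] by blast
    moreover have "\<forall>\<^sub>F K' in nhds K. K' \<in> stab"
      using open_stab K by (rule eventually_nhds_in_open)
    ultimately have "\<forall>\<^sub>F K' in nhds K. K' \<in> ?S" by eventually_elim simp
    then have "K \<in> interior ?S" unfolding eventually_nhds interior_def by blast
    then show False using notint by contradiction
  qed
qed

text \<open>
  Between the cost \<open>cost K0\<close> and the frontier cost \<open>2 * cost K0\<close> a Lipschitz function needs a distance of at
  least \<open>cost K0 / l\<close>.
\<close>
lemma frontier_distance_pos:
  assumes K0: "K0 \<in> stab" "0 < cost K0" and "0 < l"
    and lip: "l-lipschitz_on {K \<in> stab. cost K \<le> 2 * cost K0} cost"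
  shows "0 < (INF K\<in>{K \<in> stab. cost K \<le> cost K0}. infdist K (frontier {K \<in> stab. cost K \<le> 2 * cost K0}))"
proof -
  let ?S = "{K \<in> stab. cost K \<le> 2 * cost K0}" and ?T = "{K \<in> stab. cost K \<le> cost K0}"
  have "K0 \<in> ?S" using K0 by simp
  then have ne: "frontier ?S \<noteq> {}"
    using sublevel_not_UNIV[of "2 * cost K0"] unfolding frontier_eq_empty by blast
  have "cost K0 / l \<le> infdist K (frontier ?S)" if "K \<in> ?T" for K
    unfolding infdist_notempty[OF ne]
  proof (rule cINF_greatest[OF ne])
    fix F assume "F \<in> frontier ?S"
    then have F: "F \<in> stab" "cost F = 2 * cost K0" by (rule cost_at_frontier)+
    have "dist (cost F) (cost K) \<le> l * dist F K"
      using that F K0 by (intro lipschitz_onD[OF lip]) auto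
    then have "cost K0 \<le> l * dist K F" using F that by (simp add: dist_real_def dist_commute abs_le_iff)
    then show "cost K0 / l \<le> dist K F" using \<open>0 < l\<close> by (simp add: field_simps)
  qed
  then have "cost K0 / l \<le> (INF K\<in>?T. infdist K (frontier ?S))"
    using K0 by (intro cINF_greatest) auto
  moreover have "0 < cost K0 / l" using K0 \<open>0 < l\<close> by simp
  ultimately show ?thesis by linarith
qed

end

text \<open>
  A connected set that meets \<open>S\<close> but not its frontier lies in \<open>S\<close>.
\<close>
lemma ball_subset_interior_of_frontier_distance:
  fixes S :: "'a::real_normed_vector set"
  assumes "x \<in> S" "d \<le> infdist x (frontier S)" 
  shows "ball x d \<subseteq> interior S"
proof (rule interior_maximal)
  show "ball x d \<subseteq> S"
  proof (rule ccontr)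
    assume "\<not> ball x d \<subseteq> S"
    then obtain y where y: "y \<in> ball x d" "y \<notin> S" by blast
    then have "0 < d" using zero_le_dist[of x y] by (simp, linarith)
    have "ball x d \<inter> frontier S \<noteq> {}"
    proof (rule connected_Int_frontier)
      show "ball x d \<inter> S \<noteq> {}" using \<open>0 < d\<close> assms(1) centre_in_ball by blast
    qed (use y in auto)
    then obtain z where "dist x z < d" "z \<in> frontier S" by auto
    then show False using infdist_le[of z "frontier S" x] assms(2) by linarith
  qed
qed simp

section \<open>The models keep their minimizers in the safe ball\<close>

theorem lemma8:
  fixes A :: "real ^ 'x ^ 'x" and B :: "real ^ 'u ^ 'x" and Bw :: "real ^ 'w ^ 'x"
    and C :: "real ^ 'x ^ 'y" and Q :: "real ^ 'x ^ 'x" and R :: "real ^ 'u ^ 'u"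
    and J :: "real ^ 'y ^ 'u \<Rightarrow> real"
    and KK KK0 KKt0 :: "(real ^ 'y ^ 'u) set" and K0 Kt :: "real ^ 'y ^ 'u"
    and m l lM d \<rho> :: real
    and kind :: "nat \<Rightarrow> model_kind" and M :: "nat \<Rightarrow> real ^ 'y ^ 'u \<Rightarrow> real"
    and L G :: "nat \<Rightarrow> real ^ 'y ^ 'u"
    and model :: "nat \<Rightarrow> real ^ 'y ^ 'u \<Rightarrow> real"
    and k :: nat
  assumes "stabilizable A B"
    and "full_row_rank Bw" and "full_row_rank C"
    and "pos_def Q" and "pos_def R"
    and KK: "KK = stabilizing_gains A B C" and "KK \<noteq> {}"
    and J: "J = hinf_cost A B Bw C Q R"
    and "K0 \<in> KK" and "J K0 > (INF K\<in>KK. J K)"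
    and KK0: "KK0 = {K \<in> KK. J K \<le> J K0}"
    and KKt0: "KKt0 = {K \<in> KK. J K \<le> 2 * J K0}"
    and "m > 0" and "\<And>U. convex U \<Longrightarrow> U \<subseteq> KKt0 \<Longrightarrow> weakly_convex_on m U J"
    and "l > 0" and "l-lipschitz_on KKt0 J"
    and d: "d = (INF K\<in>KK0. infdist K (frontier KKt0))"
    and "Kt \<in> KK0"
    and "lM \<ge> 0" and "(\<forall>i\<ge>1. kind i \<noteq> General) \<longrightarrow> lM = 0"
    and "\<rho> > max (l / d + m) (lM / d)"
    and model: "model = lower_model J m \<rho> Kt kind M L G"
    and "L 0 = Kt" and "G 0 \<in> frechet_subdiff J (L 0)"
    and "\<And>i. 1 \<le> i \<Longrightarrow> i \<le> k \<Longrightarrow> G i - m *\<^sub>R (L i - Kt) \<in> frechet_subdiff J (L i)"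
    and "\<And>i. 1 \<le> i \<Longrightarrow> i \<le> k \<Longrightarrow> kind i \<noteq> Full_Memory \<Longrightarrow>
           \<rho> *\<^sub>R (Kt - L i) \<in> frechet_subdiff (model (i - 1)) (L i)"
    and "\<And>i. 1 \<le> i \<Longrightarrow> i \<le> k \<Longrightarrow> kind i = General \<Longrightarrow>
           lM-lipschitz_on KKt0 (M i) \<and> convex_on UNIV (M i) \<and>
           (\<forall>X\<in>largest_ball_in (interior KKt0) Kt. M i X \<le> J X + m / 2 * (norm (X - Kt))\<^sup>2)"
    and "\<And>i. i < k \<Longrightarrow>
           is_arg_min (\<lambda>X. model i X + \<rho> / 2 * (norm (X - Kt))\<^sup>2) (\<lambda>_. True) (L (Suc i))"
  shows "\<exists>Lnext.
      (\<forall>X. is_arg_min (\<lambda>X. model k X + \<rho> / 2 * (norm (X - Kt))\<^sup>2) (\<lambda>_. True) X \<longleftrightarrow> X = Lnext) \<and>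
      norm (Lnext - Kt) < d \<and> Lnext \<in> interior KKt0"
proof -
  note shifted_subgrad = assms(25) and extra_model = assms(27) and argmin = assms(28)
  interpret hinf_problem A B Bw C Q R by unfold_locales fact+
  have K0: "K0 \<in> stab" using \<open>K0 \<in> KK\<close> KK by simp
  have "0 \<le> (INF K\<in>KK. J K)"
    using \<open>KK \<noteq> {}\<close> cost_nonneg by (intro cINF_greatest) (simp_all add: KK J)
  then have "0 < cost K0" using \<open>J K0 > (INF K\<in>KK. J K)\<close> J by simp
  then have "0 < d"
    using frontier_distance_pos[OF K0 _ \<open>l > 0\<close>] \<open>l-lipschitz_on KKt0 J\<close>
    by (simp add: d KK0 KKt0 KK J)
  have "Kt \<in> KKt0" using \<open>Kt \<in> KK0\<close> \<open>0 < cost K0\<close> by (simp add: KK0 KKt0 J)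
  moreover have "d \<le> infdist Kt (frontier KKt0)"
    unfolding d using \<open>Kt \<in> KK0\<close>
    by (intro cINF_lower bdd_belowI2[of _ 0]) (simp_all add: infdist_nonneg)
  ultimately have ball: "ball Kt d \<subseteq> interior KKt0"
    by (rule ball_subset_interior_of_frontier_distance)
  have "l / d + m < \<rho>" "lM / d < \<rho>" using \<open>\<rho> > max (l / d + m) (lM / d)\<close> by simp_all
  then have slopes: "l + m * d < \<rho> * d" "lM < \<rho> * d" using \<open>0 < d\<close> by (simp_all add: field_simps)
  have "0 < \<rho>" using \<open>l / d + m < \<rho>\<close> \<open>0 < d\<close> \<open>l > 0\<close> \<open>m > 0\<close> by (smt (verit) divide_pos_pos)
  have step: "\<exists>X0. (\<forall>X. is_arg_min (\<lambda>X. model n X + \<rho> / 2 * (norm (X - Kt))\<^sup>2) (\<lambda>_. True) X \<longleftrightarrow> X = X0)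
      \<and> norm (X0 - Kt) < d"
    if "n \<le> k" and near: "\<And>i. i \<le> n \<Longrightarrow> norm (L i - Kt) < d" for n
  proof -
    have int: "L i \<in> interior KKt0" if "i \<le> n" for i
      using near[OF that] ball by (auto simp: dist_norm norm_minus_commute)
    have "norm (G i) < \<rho> * d" if "i \<le> n" for i
    proof (cases "i = 0")
      case True
      have "norm (G 0) \<le> l"
        using frechet_subdiff_norm_le[OF \<open>l-lipschitz_on KKt0 J\<close> int[of 0] \<open>G 0 \<in> frechet_subdiff J (L 0)\<close>] by simp
      moreover have "0 < m * d" using \<open>m > 0\<close> \<open>0 < d\<close> by simp
      ultimately show ?thesis using slopes(1) True by simp
    next
      case False
      then have "norm (G i - m *\<^sub>R (L i - Kt)) \<le> l"
        using frechet_subdiff_norm_le[OF \<open>l-lipschitz_on KKt0 J\<close> int[OF that] shifted_subgrad] that \<open>n \<le> k\<close> by simp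
      moreover have "norm (m *\<^sub>R (L i - Kt)) \<le> m * d"
        using near[OF that] \<open>m > 0\<close> by simp
      ultimately show ?thesis
        using norm_triangle_sub[of "G i" "m *\<^sub>R (L i - Kt)"] slopes(1) by linarith
    qed
    moreover have "norm (\<rho> *\<^sub>R (Kt - L i)) < \<rho> * d" if "i \<le> n" for i
      using near[OF that] \<open>0 < \<rho>\<close> by (simp add: norm_minus_commute)
    moreover have "convex_lipschitz_below (\<rho> * d) (ball Kt d) (M i)"
      if "1 \<le> i" "i \<le> n" "kind i = General" for i
    proof -
      have "lM-lipschitz_on KKt0 (M i)" "convex_on UNIV (M i)"
        using extra_model[OF that(1) _ that(3)] that(2) \<open>n \<le> k\<close> by simp_all
      moreover have "ball Kt d \<subseteq> KKt0" using ball interior_subset by blast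
      ultimately show ?thesis
        unfolding convex_lipschitz_below_def using slopes(2) lipschitz_on_subset by blast
    qed
    ultimately have "convex_lipschitz_below (\<rho> * d) (ball Kt d) (model n)"
      unfolding model by (intro lower_model_convex_lipschitz_below) auto
    then show ?thesis
      unfolding convex_lipschitz_below_def using proximal_step_in_ball \<open>0 < d\<close> by blast
  qed
  \<comment> \<open>Each iterate is the minimizer of the preceding model, which \<open>step\<close> locates once the earlier iterates are located.\<close>
  have near: "norm (L i - Kt) < d" if "i \<le> k" for i
    using that
  proof (induction i rule: less_induct)
    case (less i)
    show ?case
    proof (cases i)
      case 0
      then show ?thesis using \<open>L 0 = Kt\<close> \<open>0 < d\<close> by simp
    next
      case (Suc n)
      then obtain X0 where X0: "norm (X0 - Kt) < d"
        "\<And>X. is_arg_min (\<lambda>X. model n X + \<rho> / 2 * (norm (X - Kt))\<^sup>2) (\<lambda>_. True) X \<longleftrightarrow> X = X0"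
        using step[of n] less by auto
      have "L i = X0" using argmin[of n] X0(2) Suc less.prems by simp
      then show ?thesis using X0(1) by simp
    qed
  qed
  obtain X0 where X0: "norm (X0 - Kt) < d"
    "\<forall>X. is_arg_min (\<lambda>X. model k X + \<rho> / 2 * (norm (X - Kt))\<^sup>2) (\<lambda>_. True) X \<longleftrightarrow> X = X0"
    using step[of k] near by blast
  moreover have "X0 \<in> interior KKt0"
    using X0(1) ball by (auto simp: dist_norm norm_minus_commute)
  ultimately show ?thesis by blast
qed

end
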